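(* Let $n$ be a nonnegative integer and let $k,m,a$ be complex numbers with $a\neq0$ such that all the functions below are defined. Then $$\sum _{p=0}^n \left(i 2^p\right)^k e^{i m 2^{p+1}} \left(\Phi \left(-e^{i 2^{p+1} m},-k,1-i 2^{-p-1} \log (a)\right)+\Phi \left(e^{i 2^{p+1} m},-k,1-i 2^{-p-1} \log (a)\right)\right)$$ $$=-2 \left(\left(i 2^{n+1}\right)^k e^{i m 2^{n+2}}\, \Phi \left(e^{i 2^{n+2} m},-k,1-i 2^{-n-2} \log (a)\right)-i^k e^{2 i m}\, \Phi \left(e^{2 i m},-k,1-\tfrac{1}{2} i \log (a)\right)\right).$$
   Context: $\Phi(z,s,v)$ is the Hurwitz–Lerch zeta function: $\Phi(z,s,v)=\sum_{j=0}^{\infty}\frac{z^j}{(j+v)^s}$ for $v\notin\{0,-1,-2,\dots\}$ and $|z|<1$ (or $|z|=1$, $\operatorname{Re}s>1$), and by analytic continuation (principal branch, cut along $z\in[1,\infty)$) for other values; $\Phi(1,s,v)$ is the Hurwitz zeta function $\zeta(s,v)$. Logarithms and powers are principal values. *)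

theory Defs
  imports "HOL-Complex_Analysis.Complex_Analysis"
begin

text \<open>
  Complex powers are \<open>powr\<close> and logarithms are \<open>Ln\<close>, i.e. principal values with
  argument in \<open>(-\<pi>, \<pi>]\<close>. In both definitions below the holomorphic function \<open>f\<close> is
  determined on the stated domain, since that domain is connected.
\<close>

definition hurwitz_zeta :: "complex \<Rightarrow> complex \<Rightarrow> complex" where
  "hurwitz_zeta s v =
     (if Re s > 1 then (\<Sum>j. 1 / (of_nat j + v) powr s)
      else (THE w. \<exists>f. f holomorphic_on (- {1}) \<and>
              (\<forall>s'. Re s' > 1 \<longrightarrow> f s' = (\<Sum>j. 1 / (of_nat j + v) powr s')) \<and>
              f s = w))"

text \<open>
  Outside the region of convergence, the continuation is taken in the variable \<open>z\<close>, from the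
  unit disc to the plane cut along \<open>[1, \<infinity>)\<close>, with \<open>s\<close> and \<open>v\<close> fixed. At the branch point
  \<open>z = 1\<close> the value is that of the Hurwitz zeta function, which is continued in \<open>s\<close>.
\<close>

definition lerch_phi :: "complex \<Rightarrow> complex \<Rightarrow> complex \<Rightarrow> complex" where
  "lerch_phi z s v =
     (if z = 1 then hurwitz_zeta s v
      else if norm z < 1 \<or> norm z = 1 \<and> Re s > 1
        then (\<Sum>j. z ^ j / (of_nat j + v) powr s)
      else (THE w. \<exists>f. f holomorphic_on (- (of_real ` {1..})) \<and>
              (\<forall>z'. norm z' < 1 \<longrightarrow> f z' = (\<Sum>j. z' ^ j / (of_nat j + v) powr s)) \<and>
              f z = w))"

text \<open>
  The arguments at which \<open>lerch_phi\<close> is meaningful: the open half-line \<open>z > 1\<close> of the branch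
  cut is excluded, and so is the pole \<open>s = 1\<close> of the Hurwitz zeta function when \<open>z = 1\<close>.
\<close>

definition lerch_phi_defined :: "complex \<Rightarrow> complex \<Rightarrow> complex \<Rightarrow> bool" where
  "lerch_phi_defined z s v \<longleftrightarrow>
     v \<notin> \<int>\<^sub>\<le>\<^sub>0 \<and> (z \<notin> of_real ` {1..} \<or> z = 1 \<and> s \<noteq> 1)"

end

theory Submission
  imports Defs "HOL-Real_Asymp.Real_Asymp"
begin

text \<open>
  Write \<open>s = -k\<close>, \<open>z\<^sub>p = exp (\<i> 2^(p+1) m)\<close> and \<open>v\<^sub>p = 1 - \<i> Ln a / 2^(p+1)\<close>. Subtracting the
  series of \<open>\<Phi>(-z, s, v)\<close> from that of \<open>\<Phi>(z, s, v)\<close> leaves the terms of odd index, and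
  \<open>2j + 1 + v = 2 (j + (v + 1)/2)\<close>, so that
    \<open>\<Phi>(z, s, v) - \<Phi>(-z, s, v) = 2^(1-s) z \<Phi>(z\<^sup>2, s, (v + 1)/2)\<close>.
  The parameters are made for this identity: \<open>z\<^bsub>p+1\<^esub> = (z\<^sub>p)\<^sup>2\<close>, \<open>v\<^bsub>p+1\<^esub> = (v\<^sub>p + 1)/2\<close>, and the factor
  \<open>(\<i> 2\<^sup>p)\<^sup>k\<close> grows by \<open>2\<^sup>k\<close> at each step. Hence the summand with index \<open>p\<close> is \<open>2 T\<^sub>p - 2 T\<^bsub>p+1\<^esub>\<close> with
  \<open>T\<^sub>p = (\<i> 2\<^sup>p)\<^sup>k z\<^sub>p \<Phi>(z\<^sub>p, s, v\<^sub>p)\<close>, and the sum telescopes.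

  The difficulty is the identity (\<open>lerch_phi_odd_part\<close>) outside the region of convergence, where
  the values of \<open>\<Phi>\<close> are definite descriptions that denote the intended value only if an analytic
  continuation exists.

  For \<open>z \<noteq> \<plusminus>1\<close> the continuation is in \<open>z\<close>, and the identity spreads from the unit disc to the plane
  without the two rays \<open>\<bar>z\<bar> \<ge> 1\<close> of the real axis by the identity theorem. The continuation
  exists (\<open>ex_lerch_continuation\<close>) because, for \<open>1 < Re s < Re v - 1\<close>,
  \<open>\<Gamma>(s) (j + v)^(-s)\<close> is the \<open>j\<close>-th moment of a continuous weight on \<open>[0, 1]\<close>, so that the series sums
  to the Stieltjes transform of that weight, which is holomorphic off \<open>[1, \<infinity>)\<close>. The operator
  \<open>z d/dz + v\<close> lowers \<open>s\<close> by \<open>1\<close>, and splitting off the first term of the series lowers \<open>v\<close> by \<open>1\<close>.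

  For \<open>z = \<plusminus>1\<close> and \<open>Re s \<le> 1\<close> the branch point is involved, and the continuation has to be in \<open>s\<close>.
  The identity holds for \<open>Re s > 1\<close>, hence wherever both sides are holomorphic in \<open>s\<close>. This needs
  that the value at \<open>z = -1\<close> of the continuation in \<open>z\<close> is an entire function of \<open>s\<close>
  (\<open>holomorphic_continuation_at_minus_1\<close>), and that \<open>(s - 1) \<zeta>(s, v)\<close> extends to an entire function
  (\<open>ex_hurwitz_continuation\<close>). Both follow from the Taylor expansion of \<open>(j + 1 + v)^(-s)\<close> in powers of
  \<open>j + v\<close>: the remainder after \<open>K\<close> terms is summable over \<open>j\<close> for \<open>Re s > 1 - K\<close>, and summing the
  expansion over \<open>j\<close> expresses the function at \<open>s\<close> through its values at \<open>s + 1, s + 2, \<dots>\<close>. So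
  holomorphy on a half-plane propagates to a half-plane that is larger by a strip of width \<open>1\<close>.
\<close>

section \<open>Taylor remainders of shifted powers\<close>

lemma of_nat_plus_nonzero:
  assumes "v \<notin> \<int>\<^sub>\<le>\<^sub>0"
  shows   "of_nat j + v \<noteq> (0 :: complex)"
proof
  assume "of_nat j + v = 0"
  hence "v = - of_nat j"
    by (simp add: eq_neg_iff_add_eq_0 add.commute)
  with assms show False by simp
qed

text \<open>
  Only large \<open>j\<close> matter for convergence. For them \<open>j + v\<close> lies in the right half-plane, where
  principal powers are multiplicative as far as needed.
\<close>
lemma eventually_large_shift:
  fixes v :: complex
  shows "\<forall>\<^sub>F j in sequentially. Re (of_nat j + v) > 0 \<and> norm (of_nat j + v) \<ge> 2 \<and> j > 0 \<and>
           norm (of_nat j + v) \<ge> real j / 2 \<and> norm (of_nat j + v) \<le> 2 * real j"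
proof -
  have "\<forall>\<^sub>F j in sequentially. real j \<ge> 4 + 2 * norm v"
    by real_asymp
  thus ?thesis
  proof eventually_elim
    case (elim j)
    have 1: "norm (of_nat j + v) \<ge> real j - norm v"
      using norm_triangle_ineq4[of "of_nat j + v" v] by simp
    have 2: "norm (of_nat j + v) \<le> real j + norm v"
      using norm_triangle_ineq[of "of_nat j" v] by simp
    have 3: "\<bar>Re v\<bar> \<le> norm v"
      by (rule abs_Re_le_cmod)
    show ?case using 1 2 3 elim norm_ge_zero[of v] by auto
  qed
qed

text \<open>
  The argument of \<open>j + v\<close> contributes only a factor that is bounded on bounded sets of exponents,
  and \<open>\<bar>j + v\<bar>\<close> is comparable to \<open>j\<close>.
\<close>
lemma shift_powr_bound:
  fixes v :: complex
  assumes "bounded S" and \<sigma>: "\<And>s. s \<in> S \<Longrightarrow> \<sigma> \<le> Re s"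
  shows   "\<exists>C\<ge>0. \<forall>\<^sub>F j in sequentially. \<forall>s\<in>S.
             norm ((of_nat j + v) powr (-s)) \<le> C * real j powr (-\<sigma>)"
proof -
  obtain B where B: "\<And>s. s \<in> S \<Longrightarrow> norm s \<le> B"
    using \<open>bounded S\<close> by (auto simp: bounded_iff)
  define C where "C = 2 powr \<bar>\<sigma>\<bar> * exp (\<bar>B\<bar> * pi)"
  have "\<forall>\<^sub>F j in sequentially. \<forall>s\<in>S.
             norm ((of_nat j + v) powr (-s)) \<le> C * real j powr (-\<sigma>)"
    using eventually_large_shift[of v]
  proof eventually_elim
    case (elim j)
    define w where "w = of_nat j + v"
    from elim have w: "Re w > 0" "norm w \<ge> 2" "j > 0" "norm w \<ge> real j / 2" "norm w \<le> 2 * real j"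
      by (auto simp: w_def)
    show ?case
    proof
      fix s assume s: "s \<in> S"
      have "norm w powr (-Re s) \<le> norm w powr (-\<sigma>)"
        using w \<sigma>[OF s] by (intro powr_mono) auto
      also have "\<dots> = (norm w / real j) powr (-\<sigma>) * real j powr (-\<sigma>)"
        using w by (simp add: powr_divide)
      also have "\<dots> \<le> 2 powr \<bar>\<sigma>\<bar> * real j powr (-\<sigma>)"
      proof (intro mult_right_mono)
        show "(norm w / real j) powr (-\<sigma>) \<le> 2 powr \<bar>\<sigma>\<bar>"
        proof (cases "\<sigma> \<le> 0")
          case True
          thus ?thesis using w by (auto simp: field_simps intro!: powr_mono2)
        next
          case False
          have "(norm w / real j) powr (-\<sigma>) \<le> (1 / 2) powr (-\<sigma>)"
            using w False by (intro powr_mono2') (auto simp: field_simps)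
          thus ?thesis using False by (simp add: powr_minus powr_divide)
        qed
      qed auto
      finally have 1: "norm w powr (-Re s) \<le> 2 powr \<bar>\<sigma>\<bar> * real j powr (-\<sigma>)" .
      have "\<bar>Im s * Arg w\<bar> \<le> \<bar>B\<bar> * pi"
        unfolding abs_mult using abs_Im_le_cmod[of s] B[OF s] Arg_bounded[of w]
        by (intro mult_mono) auto
      hence 2: "exp (Im s * Arg w) \<le> exp (\<bar>B\<bar> * pi)" by simp
      have "norm (w powr (-s)) = norm w powr (-Re s) * exp (Im s * Arg w)"
        by (simp add: norm_powr_complex)
      also have "\<dots> \<le> (2 powr \<bar>\<sigma>\<bar> * real j powr (-\<sigma>)) * exp (\<bar>B\<bar> * pi)"
        by (intro mult_mono 1 2) auto
      finally show "norm ((of_nat j + v) powr (-s)) \<le> C * real j powr (-\<sigma>)"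
        by (simp add: C_def w_def mult_ac)
    qed
  qed
  moreover have "C \<ge> 0" by (simp add: C_def)
  ultimately show ?thesis by blast
qed

lemma Suc_gbinomial_Suc:
  "of_nat (Suc k) * ((a :: complex) gchoose Suc k) = (a - of_nat k) * (a gchoose k)"
  using gbinomial_mult_1[of a k] by (simp add: algebra_simps)

lemma fact_gbinomial_Suc:
  "fact (Suc k) * ((a :: complex) gchoose Suc k) = fact k * (a gchoose k) * (a - of_nat k)"
  using gbinomial_mult_1[of a k] by (simp add: algebra_simps)

text \<open>
  By Taylor's formula the remainder of the binomial series is bounded by the \<open>K\<close>-th derivative in
  \<open>y\<close>, and this derivative is a continuous function of \<open>(s, y)\<close> on a compact set. Compactness gives
  the uniformity in \<open>s\<close> that holomorphy of the sums of remainders requires.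
\<close>
lemma binomial_remainder_bound:
  fixes S :: "complex set"
  assumes "compact S"
  shows "\<exists>M\<ge>0. \<forall>s\<in>S. \<forall>y\<in>cball 0 (1/2).
           norm ((1 + y) powr (-s) - (\<Sum>k<K. ((-s) gchoose k) * y ^ k)) \<le> M * norm y ^ K"
proof -
  define f where "f = (\<lambda>s i y. fact i * ((-s) gchoose i) * (1 + y) powr (-s - of_nat i :: complex))"
  have Re_pos: "Re (1 + y) > 0" if "y \<in> cball 0 (1/2)" for y
    using that abs_Re_le_cmod[of y] by auto
  have deriv: "(f s i has_field_derivative f s (Suc i) y) (at y within cball 0 (1/2))"
    if "y \<in> cball 0 (1/2)" for s i y
  proof -
    have "1 + y \<notin> \<real>\<^sub>\<le>\<^sub>0"
      using Re_pos[OF that] by (auto simp: complex_nonpos_Reals_iff)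
    thus ?thesis
      unfolding f_def fact_gbinomial_Suc
      by (auto intro!: derivative_eq_intros simp: algebra_simps)
  qed
  have bd: "bounded ((\<lambda>(s, y). f s K y) ` (S \<times> cball 0 (1/2)))"
  proof (intro compact_imp_bounded compact_continuous_image compact_Times assms compact_cball)
    have nz: "1 + snd p \<noteq> 0" if "p \<in> S \<times> cball 0 (1/2)" for p :: "complex \<times> complex"
      using Re_pos[of "snd p"] that by (auto simp: complex_eq_iff mem_Times_iff)
    have "continuous_on (S \<times> cball 0 (1/2)) (\<lambda>p. f (fst p) K (snd p))"
      unfolding f_def gbinomial_prod_rev
      by (intro continuous_intros) (use nz Re_pos in \<open>fastforce simp: mem_Times_iff\<close>)+
    thus "continuous_on (S \<times> cball 0 (1/2)) (\<lambda>(s, y). f s K y)"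
      by (simp add: case_prod_unfold)
  qed
  then obtain B where B: "\<And>s y. s \<in> S \<Longrightarrow> y \<in> cball 0 (1/2) \<Longrightarrow> norm (f s K y) \<le> B"
    unfolding bounded_iff by force
  have main: "norm ((1 + y) powr (-s) - (\<Sum>k<K. ((-s) gchoose k) * y ^ k)) \<le> \<bar>B\<bar> * norm y ^ K"
    if sy: "s \<in> S" "y \<in> cball 0 (1/2)" for s y
  proof (cases K)
    case 0
    thus ?thesis using B[OF sy] by (simp add: f_def)
  next
    case (Suc n)
    have "norm (f s 0 y - (\<Sum>i\<le>n. f s i 0 * (y - 0) ^ i / fact i))
            \<le> \<bar>B\<bar> * norm (y - 0) ^ Suc n / fact n"
    proof (rule complex_Taylor[of "cball 0 (1/2)"])
      show "norm (f s (Suc n) x) \<le> \<bar>B\<bar>" if "x \<in> cball 0 (1/2)" for x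
        using B[OF sy(1) that] Suc by simp
    qed (use deriv sy in auto)
    also have "(\<Sum>i\<le>n. f s i 0 * (y - 0) ^ i / fact i) = (\<Sum>k<K. ((-s) gchoose k) * y ^ k)"
      unfolding Suc lessThan_Suc_atMost by (intro sum.cong) (auto simp: f_def)
    also have "\<bar>B\<bar> * norm (y - 0) ^ Suc n / fact n \<le> \<bar>B\<bar> * norm y ^ Suc n"
      using mult_left_le[of "1 / fact n" "\<bar>B\<bar> * norm y ^ Suc n"] by simp
    finally show ?thesis by (simp add: Suc f_def)
  qed
  show ?thesis
    by (intro exI[of _ "\<bar>B\<bar>"] conjI ballI) (use main in auto)
qed

text \<open>
  The Taylor remainder after \<open>K\<close> terms of \<open>t \<mapsto> (j + t + v)^(-s)\<close>, expanded at \<open>t = 0\<close> and evaluated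
  at \<open>t = 1\<close>.
\<close>
definition power_remainder :: "nat \<Rightarrow> complex \<Rightarrow> complex \<Rightarrow> nat \<Rightarrow> complex" where
  "power_remainder K s v j = (of_nat (Suc j) + v) powr (-s) -
     (\<Sum>k<K. ((-s) gchoose k) * (of_nat j + v) powr (-s - of_nat k))"

text \<open>
  Factoring out \<open>w^(-s)\<close> is legitimate for principal powers, since \<open>w\<close> and \<open>1 + 1/w\<close> both lie in the
  right half-plane and their arguments therefore add up to less than \<open>\<pi>\<close>.
\<close>
lemma power_remainder_eq:
  assumes w: "Re w > 0"
  shows "(w + 1) powr (-s) - (\<Sum>k<K. ((-s) gchoose k) * w powr (-s - of_nat k)) =
         w powr (-s) * ((1 + 1 / w) powr (-s) - (\<Sum>k<K. ((-s) gchoose k) * (1 / w) ^ k))"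
proof -
  have [simp]: "w \<noteq> 0" using w by auto
  have "Re (1 + 1 / w) > 0"
    using w by (simp add: Re_divide add_pos_nonneg)
  hence "\<bar>Im (Ln (1 + 1 / w))\<bar> < pi / 2" "1 + 1 / w \<noteq> 0"
    using Re_Ln_pos_lt[of "1 + 1 / w"] by (metis zero_complex.sel(1) less_irrefl)+
  moreover have "\<bar>Im (Ln w)\<bar> < pi / 2"
    using Re_Ln_pos_lt[of w] w by auto
  ultimately have "Ln (w * (1 + 1 / w)) = Ln w + Ln (1 + 1 / w)"
    using \<open>w \<noteq> 0\<close> by (intro Ln_times_simple; unfold abs_less_iff; linarith?)
  also have "w * (1 + 1 / w) = w + 1" by (simp add: field_simps)
  finally have Ln_eq: "Ln (w + 1) = Ln w + Ln (1 + 1 / w)" .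
  have "w + 1 \<noteq> 0" using w by (auto simp: complex_eq_iff)
  hence "(w + 1) powr (-s) = w powr (-s) * (1 + 1 / w) powr (-s)"
    using \<open>1 + 1 / w \<noteq> 0\<close> \<open>w \<noteq> 0\<close>
    unfolding powr_def Ln_eq by (simp only: if_False ring_distribs exp_add)
  moreover have "w powr (-s - of_nat k) = w powr (-s) * (1 / w) ^ k" for k
    by (simp add: powr_diff power_divide)
  ultimately show ?thesis
    by (simp add: right_diff_distrib sum_distrib_left mult_ac)
qed

text \<open>
  Each Taylor term that is removed gains one power of \<open>j\<close>. This is what pushes the half-plane of
  convergence to the left.
\<close>
lemma power_remainder_bound:
  fixes v :: complex
  assumes "compact S" and \<sigma>: "\<And>s. s \<in> S \<Longrightarrow> \<sigma> \<le> Re s"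
  shows   "\<exists>C. \<forall>\<^sub>F j in sequentially. \<forall>s\<in>S.
             norm (power_remainder K s v j) \<le> C * real j powr (-(\<sigma> + real K))"
proof -
  obtain C where C: "C \<ge> 0" "\<forall>\<^sub>F j in sequentially. \<forall>s\<in>S.
      norm ((of_nat j + v) powr (-s)) \<le> C * real j powr (-\<sigma>)"
    using shift_powr_bound[OF compact_imp_bounded[OF \<open>compact S\<close>] \<sigma>] by blast
  obtain M where M: "M \<ge> 0" "\<And>s y. s \<in> S \<Longrightarrow> y \<in> cball 0 (1/2) \<Longrightarrow>
      norm ((1 + y) powr (-s) - (\<Sum>k<K. ((-s) gchoose k) * y ^ k)) \<le> M * norm y ^ K"
    using binomial_remainder_bound[OF \<open>compact S\<close>, of K] by blast
  have "\<forall>\<^sub>F j in sequentially. \<forall>s\<in>S.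
          norm (power_remainder K s v j) \<le> (C * M * 2 ^ K) * real j powr (-(\<sigma> + real K))"
    using C(2) eventually_large_shift[of v]
  proof eventually_elim
    case (elim j)
    define w where "w = of_nat j + v"
    from elim have w: "Re w > 0" "norm w \<ge> 2" "j > 0" "norm w \<ge> real j / 2"
      by (auto simp: w_def)
    show ?case
    proof
      fix s assume s: "s \<in> S"
      have y: "1 / w \<in> cball 0 (1/2)"
        using frac_le[of 1 1 2 "norm w"] w(2) by (simp only: mem_cball_0 norm_divide norm_one)
      have "power_remainder K s v j =
              w powr (-s) * ((1 + 1 / w) powr (-s) - (\<Sum>k<K. ((-s) gchoose k) * (1 / w) ^ k))"
        unfolding power_remainder_eq[OF w(1), symmetric]
        by (simp add: power_remainder_def w_def add_ac)
      also have "norm \<dots> \<le> (C * real j powr (-\<sigma>)) * (M * norm (1 / w) ^ K)"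
        unfolding norm_mult using elim(1) s C(1) by (intro mult_mono M y) (auto simp: w_def)
      also have "\<dots> \<le> (C * real j powr (-\<sigma>)) * (M * (2 / real j) ^ K)"
        using w C(1) M(1)
        by (intro mult_left_mono power_mono mult_nonneg_nonneg)
           (auto simp: norm_divide frac_le[of 1 1 "real j / 2" "norm w", simplified])
      also have "\<dots> = (C * M * 2 ^ K) * real j powr (-(\<sigma> + real K))"
        using w by (simp add: powr_diff powr_minus powr_realpow power_divide field_simps)
      finally show "norm (power_remainder K s v j) \<le> (C * M * 2 ^ K) * real j powr (-(\<sigma> + real K))" .
    qed
  qed
  thus ?thesis by blast
qed

lemma power_remainder_abs_summable:
  assumes "Re s > 1 - real K"
  shows   "summable (\<lambda>j. norm (power_remainder K s v j))"
proof -
  obtain C where "\<forall>\<^sub>F j in sequentially. \<forall>s\<in>{s}.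
      norm (power_remainder K s v j) \<le> C * real j powr (-(Re s + real K))"
    using power_remainder_bound[of "{s}" "Re s" K v] by auto
  moreover have "summable (\<lambda>j. C * real j powr (-(Re s + real K)))"
    using assms by (intro summable_mult) (simp add: summable_real_powr_iff)
  ultimately show ?thesis
    by (elim summable_comparison_test_ev[rotated]) (auto elim!: eventually_mono)
qed

text \<open>
  The sums are needed for \<open>c = 1\<close> (Hurwitz zeta function) and \<open>c = -1\<close> (alternating series).
\<close>
lemma holomorphic_power_remainder_suminf:
  assumes v: "v \<notin> \<int>\<^sub>\<le>\<^sub>0" and c: "norm c \<le> 1"
  shows   "(\<lambda>s. \<Sum>j. c ^ j * power_remainder K s v j) holomorphic_on {s. Re s > 1 - real K}"
proof (rule holomorphic_uniform_sequence)
  show op: "open {s. Re s > 1 - real K}" by (rule open_halfspace_Re_gt)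
  show "(\<lambda>s. \<Sum>j<n. c ^ j * power_remainder K s v j) holomorphic_on {s. Re s > 1 - real K}" for n
    unfolding power_remainder_def gbinomial_prod_rev
    by (intro holomorphic_intros) (use of_nat_plus_nonzero[OF v] in \<open>auto simp del: of_nat_Suc\<close>)
  fix s assume s: "s \<in> {s. Re s > 1 - real K}"
  with op obtain d where d: "d > 0" "cball s d \<subseteq> {s. Re s > 1 - real K}"
    by (meson open_contains_cball)
  \<comment> \<open>The exponent of decay on the closed disc is governed by its leftmost point.\<close>
  have "compact (Re ` cball s d)"
    by (intro compact_continuous_image continuous_intros compact_cball)
  then obtain s0 where s0: "s0 \<in> cball s d" "\<And>t. t \<in> cball s d \<Longrightarrow> Re s0 \<le> Re t"
    using compact_attains_inf[of "Re ` cball s d"] d(1) by force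
  obtain C where C: "\<forall>\<^sub>F j in sequentially. \<forall>t\<in>cball s d.
      norm (power_remainder K t v j) \<le> C * real j powr (-(Re s0 + real K))"
    using power_remainder_bound[of "cball s d" "Re s0" K v] s0(2) by auto
  have "uniform_limit (cball s d) (\<lambda>n s. \<Sum>j<n. c ^ j * power_remainder K s v j)
          (\<lambda>s. \<Sum>j. c ^ j * power_remainder K s v j) sequentially"
  proof (rule Weierstrass_m_test_ev)
    show "\<forall>\<^sub>F j in sequentially. \<forall>t\<in>cball s d.
      norm (c ^ j * power_remainder K t v j) \<le> C * real j powr (-(Re s0 + real K))"
      using C
    proof eventually_elim
      case (elim j)
      have "norm (c ^ j) \<le> 1" using c by (simp add: norm_power power_le_one)
      thus ?case using elim
        by (auto simp: norm_mult intro!: order.trans[OF mult_left_le_one_le])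
    qed
    show "summable (\<lambda>j. C * real j powr (-(Re s0 + real K)))"
      using d(2) s0(1) by (intro summable_mult) (auto simp: summable_real_powr_iff)
  qed
  with d show "\<exists>d>0. cball s d \<subseteq> {s. Re s > 1 - real K} \<and> 
      uniform_limit (cball s d) (\<lambda>n s. \<Sum>j<n. c ^ j * power_remainder K s v j)
          (\<lambda>s. \<Sum>j. c ^ j * power_remainder K s v j) sequentially" by blast
qed

lemma continuous_on_power_series_cball:
  fixes a :: "nat \<Rightarrow> complex"
  assumes "summable (\<lambda>j. norm (a j))"
  shows   "continuous_on (cball 0 1) (\<lambda>z. \<Sum>j. z ^ j * a j)"
proof (rule uniform_limit_theorem)
  show "uniform_limit (cball 0 1) (\<lambda>n z. \<Sum>j<n. z ^ j * a j) (\<lambda>z. \<Sum>j. z ^ j * a j) sequentially"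
    using assms
    by (rule Weierstrass_m_test[rotated])
       (auto simp: norm_mult norm_power intro!: mult_left_le_one_le power_le_one)
qed (auto intro!: always_eventually continuous_intros)

section \<open>Continuation of the Lerch series in z\<close>

definition slit_plane :: "complex set" where
  "slit_plane = - (of_real ` {1..})"

lemma open_slit_plane: "open slit_plane"
  unfolding slit_plane_def by (intro open_Compl closed_slot_right)

lemma connected_slit_plane: "connected slit_plane"
  unfolding slit_plane_def by (intro starlike_imp_connected starlike_slotted_complex_plane_right)

lemma in_slit_plane_iff: "z \<in> slit_plane \<longleftrightarrow> (Im z = 0 \<longrightarrow> Re z < 1)"
  by (auto simp: slit_plane_def complex_slot_right_eq)

lemma unit_disc_subset_slit_plane: "ball 0 1 \<subseteq> slit_plane"
proof
  fix z :: complex assume "z \<in> ball 0 1"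
  thus "z \<in> slit_plane"
    using complex_Re_le_cmod[of z] by (auto simp: in_slit_plane_iff)
qed

definition neg_x_ln_x :: "real \<Rightarrow> real" where
  "neg_x_ln_x x = - (x * ln x)"

lemma neg_x_ln_x_nonneg: "x \<in> {0..1} \<Longrightarrow> neg_x_ln_x x \<ge> 0"
  by (cases "x = 0") (auto simp: neg_x_ln_x_def mult_le_0_iff)

lemma continuous_on_neg_x_ln_x: "continuous_on {0..1} neg_x_ln_x"
  unfolding continuous_on_eq_continuous_within
proof
  fix x :: real assume x: "x \<in> {0..1}"
  show "continuous (at x within {0..1}) neg_x_ln_x"
  proof (cases "x = 0")
    case True
    have "((\<lambda>x::real. - (x * ln x)) \<longlongrightarrow> 0) (at_right 0)"
      by real_asymp
    thus ?thesis
      by (simp add: True continuous_within at_within_Icc_at_right neg_x_ln_x_def[abs_def])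
  next
    case False
    with x show ?thesis
      unfolding neg_x_ln_x_def[abs_def] by (auto intro!: continuous_intros)
  qed
qed

text \<open>
  For \<open>0 < x \<le> 1\<close> this is the weight \<open>(-ln x)^(s-1) x^(w-1)\<close>. In the grouping chosen here both
  bases are continuous on \<open>[0, 1]\<close>, and for \<open>1 < Re s < Re w\<close> they vanish only under exponents with
  positive real part, so the weight is jointly continuous in \<open>(w, x)\<close> up to both endpoints.
\<close>
definition log_weight :: "complex \<Rightarrow> complex \<Rightarrow> real \<Rightarrow> complex" where
  "log_weight s w x = of_real (neg_x_ln_x x) powr (s - 1) * of_real x powr (w - s)"

lemma continuous_on_log_weight:
  assumes "Re s > 1" "\<And>w. w \<in> U \<Longrightarrow> Re w > Re s"
  shows   "continuous_on (U \<times> {0..1}) (\<lambda>(w, x). log_weight s w x)"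
proof -
  have "continuous_on (U \<times> {0..1}) (\<lambda>p. neg_x_ln_x (snd p))"
    by (rule continuous_on_compose2[OF continuous_on_neg_x_ln_x]) (auto intro!: continuous_intros)
  thus ?thesis
    unfolding log_weight_def case_prod_unfold
    using assms neg_x_ln_x_nonneg
    by (intro continuous_intros) auto
qed

lemma log_weight_eq:
  assumes "x > 0" "x \<le> 1"
  shows   "log_weight s w x = of_real (- ln x) powr (s - 1) * of_real x powr (w - 1)"
proof -
  have "of_real (neg_x_ln_x x) = of_real x * complex_of_real (- ln x)"
    by (simp add: neg_x_ln_x_def)
  hence "of_real (neg_x_ln_x x) powr (s - 1) =
           of_real x powr (s - 1) * complex_of_real (- ln x) powr (s - 1)"
    using assms by (simp only:) (rule powr_times_real, auto)
  thus ?thesis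
    using assms by (simp add: log_weight_def flip: powr_add)
qed

lemma log_weight_add_of_nat:
  assumes "x \<in> {0..1}"
  shows   "log_weight s (w + of_nat j) x = log_weight s w x * of_real x ^ j"
proof (cases "x = 0")
  case True
  thus ?thesis by (simp add: log_weight_def)
next
  case False
  hence "complex_of_real x powr (w + of_nat j - s) = of_real x powr (w - s) * of_real x ^ j"
    by (simp add: add_diff_eq[symmetric] diff_add_eq powr_add powr_diff)
  thus ?thesis by (simp add: log_weight_def)
qed

text \<open>
  Differentiation in \<open>w\<close> brings down a factor \<open>ln x\<close>, which turns the weight with parameter \<open>s\<close> into
  minus the weight with parameter \<open>s + 1\<close>. The stronger bound \<open>Re w > Re s + 1\<close> makes the latter
  continuous.
\<close>
lemma holomorphic_log_moment:
  assumes s: "Re s > 1"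
  shows   "(\<lambda>w. integral {0..1} (log_weight s w)) holomorphic_on {w. Re w > Re s + 1}"
proof -
  let ?U = "{w. Re w > Re s + 1}"
  have "(\<lambda>w. integral (cbox 0 1) (log_weight s w)) holomorphic_on ?U"
  proof (rule leibniz_rule_holomorphic[where fx = "\<lambda>w x. - log_weight (s + 1) w x"])
    fix w x assume w: "w \<in> ?U" and x: "x \<in> cbox (0::real) 1"
    show "((\<lambda>w. log_weight s w x) has_field_derivative - log_weight (s + 1) w x) (at w within ?U)"
    proof (cases "x = 0")
      \<comment> \<open>At both endpoints a base is \<open>0\<close>. Since \<open>0 powr u = 0\<close> for all \<open>u\<close>, both weights vanish there.\<close>
      case True
      thus ?thesis by (simp add: log_weight_def)
    next
      case False
      with x have x: "0 < x" "x \<le> 1" by auto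
      show ?thesis
      proof (cases "x = 1")
        case True
        thus ?thesis by (simp add: log_weight_def neg_x_ln_x_def)
      next
        case False
        with x have "ln x < 0" by simp
        hence "of_real (- ln x) powr s = of_real (- ln x) powr (s - 1) * complex_of_real (- ln x)"
          by (subst powr_diff) auto
        moreover have "((\<lambda>w. complex_of_real x powr (w - 1)) has_field_derivative
                 of_real (ln x) * of_real x powr (w - 1)) (at w within ?U)"
          using has_field_derivative_at_within[OF DERIV_shift[THEN iffD1, 
                  OF has_field_derivative_powr_right[of "of_real x" "w + (-1)"]], of ?U] x
          by (simp add: Ln_of_real)
        ultimately show ?thesis using x
          unfolding log_weight_eq[OF x]
          using DERIV_cmult[of "\<lambda>w. complex_of_real x powr (w - 1)" _ w ?U
                  "of_real (- ln x) powr (s - 1)"] by (simp add: mult.assoc)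
      qed
    qed
  next
    show "continuous_on (?U \<times> cbox 0 1) (\<lambda>(w, x). - log_weight (s + 1) w x)"
      using continuous_on_minus[OF continuous_on_log_weight[of "s + 1" ?U]] s
      by (simp add: case_prod_unfold)
    fix w assume "w \<in> ?U"
    have "continuous_on {0..1} (\<lambda>x. (case (w, x) of (w, x) \<Rightarrow> log_weight s w x))"
      by (rule continuous_on_compose2[OF continuous_on_log_weight[of s ?U]])
         (use s \<open>w \<in> ?U\<close> in \<open>auto intro!: continuous_intros\<close>)
    thus "log_weight s w integrable_on cbox 0 1"
      by (auto intro!: integrable_continuous_real)
  next
    show "convex ?U" by (rule convex_halfspace_Re_gt)
  qed
  thus ?thesis by simp
qed

lemma incomplete_Gamma_tendsto:
  assumes "Re s > 1"
  shows "((\<lambda>T. integral {0..T} (\<lambda>t. complex_of_real t powr (s - 1) / of_real (exp t)))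
            \<longlongrightarrow> Gamma s) at_top"
proof -
  let ?g = "\<lambda>t. complex_of_real t powr (s - 1) / of_real (exp t)"
  have "?g absolutely_integrable_on {0<..}"
    using assms by (intro absolutely_integrable_Gamma_integral') auto
  also have "?this \<longleftrightarrow> ?g absolutely_integrable_on {0..}"
    by (rule absolutely_integrable_spike_set_eq) (auto intro: negligible_subset[of "{0}"])
  finally have int: "?g absolutely_integrable_on {0..}" .
  have "((\<lambda>b. set_lebesgue_integral lebesgue {0..b} ?g) \<longlongrightarrow>
           set_lebesgue_integral lebesgue {0..} ?g) at_top"
    by (rule tendsto_set_lebesgue_integral_at_top) (use int in auto)
  also have "(\<lambda>b. set_lebesgue_integral lebesgue {0..b} ?g) = (\<lambda>b. integral {0..b} ?g)"
    by (intro ext set_lebesgue_integral_eq_integral(2) set_integrable_subset[OF int]) auto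
  also have "set_lebesgue_integral lebesgue {0..} ?g = integral {0..} ?g"
    by (intro set_lebesgue_integral_eq_integral(2) int)
  also have "\<dots> = Gamma s"
    using assms by (intro integral_unique Gamma_integral_complex) auto
  finally show ?thesis .
qed

text \<open>
  The substitution \<open>t = -r ln x\<close> turns the integral into Euler's integral for \<open>\<Gamma>(s)\<close>. It is carried
  out by exhibiting the antiderivative \<open>-r^(-s) I(-r ln x)\<close>, where \<open>I(T)\<close> is Euler's integral over
  \<open>[0, T]\<close>; its limit at \<open>x = 0\<close> is \<open>-r^(-s) \<Gamma>(s)\<close>.
\<close>
lemma log_moment_real:
  assumes s: "Re s > 1" and r: "r > 0"
  shows   "(log_weight s (of_real r) has_integral Gamma s * of_real r powr (-s)) {0..1}"
proof -
  define g where "g = (\<lambda>t. complex_of_real t powr (s - 1) / of_real (exp t))"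
  define I where "I = (\<lambda>T. integral {0..T} g)"
  define A where "A = (\<lambda>x. - (if x = 0 then Gamma s else I (- r * ln x)) * of_real r powr (-s))"
  have g_cont: "continuous_on {0..T} g" for T
    unfolding g_def using s by (intro continuous_intros) auto
  have I_deriv: "(I has_vector_derivative g T) (at T)" if "T > 0" for T
  proof -
    have "(I has_vector_derivative g T) (at T within {0..T + 1})"
      unfolding I_def using that by (intro integral_has_vector_derivative g_cont) auto
    also have "at T within {0..T + 1} = at T"
      using that by (intro at_within_interior) auto
    finally show ?thesis .
  qed
  have I_cont: "continuous_on {0..} I"
    unfolding continuous_on_eq_continuous_within
  proof
    fix T :: real assume T: "T \<in> {0..}"
    have "(I has_vector_derivative g T) (at T within {0..T + 1})"
      unfolding I_def using T by (intro integral_has_vector_derivative g_cont) auto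
    hence "continuous (at T within {0..T + 1}) I"
      by (rule has_vector_derivative_continuous)
    also have "at T within {0..T + 1} = at T within {0..}"
      by (rule at_within_nhd[of _ "{..<T + 1}"]) auto
    finally show "continuous (at T within {0..}) I" .
  qed
  have A_cont: "continuous_on {0..1} A"
    unfolding continuous_on_eq_continuous_within
  proof
    fix x :: real assume x: "x \<in> {0..1}"
    show "continuous (at x within {0..1}) A"
    proof (cases "x = 0")
      case True
      have "filterlim (\<lambda>x. - r * ln x) at_top (at_right 0)"
        using r by real_asymp
      hence "((\<lambda>x. I (- r * ln x)) \<longlongrightarrow> Gamma s) (at_right 0)"
        using filterlim_compose[OF incomplete_Gamma_tendsto[OF s]]
        unfolding I_def g_def by blast
      hence "((\<lambda>x. - I (- r * ln x) * of_real r powr (-s)) \<longlongrightarrow> - Gamma s * of_real r powr (-s)) (at_right 0)"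
        by (intro tendsto_intros)
      also have "?this \<longleftrightarrow> (A \<longlongrightarrow> A 0) (at_right 0)"
        by (intro filterlim_cong eventually_at_rightI[of 0 1]) (auto simp: A_def)
      finally show ?thesis
        by (simp add: True continuous_within at_within_Icc_at_right)
    next
      case False
      have "continuous_on {0<..1} (\<lambda>x. I (- r * ln x))"
        using r by (intro continuous_on_compose2[OF I_cont] continuous_intros)
                   (auto simp: mult_le_0_iff)
      hence "continuous_on {0<..1} (\<lambda>x. - I (- r * ln x) * of_real r powr (-s))"
        by (intro continuous_intros)
      also have "?this \<longleftrightarrow> continuous_on {0<..1} A"
        by (intro continuous_on_cong) (auto simp: A_def)
      finally have "continuous (at x within {0<..1}) A"
        using x False by (auto simp: continuous_on_eq_continuous_within)
      also have "at x within {0<..1} = at x within {0..1}"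
        using x False by (intro at_within_nhd[of _ "{0<..}"]) auto
      finally show ?thesis .
    qed
  qed
  have "(log_weight s (of_real r) has_integral (A 1 - A 0)) {0..1}"
  proof (rule fundamental_theorem_of_calculus_interior)
    fix x :: real assume x: "x \<in> {0<..<1}"
    hence ln: "ln x < 0" by simp
    have "((I \<circ> (\<lambda>x. - r * ln x)) has_vector_derivative ((- r / x) *\<^sub>R g (- r * ln x))) (at x)"
      using x r ln
      by (intro vector_diff_chain_at I_deriv)
         (auto intro!: derivative_eq_intros simp: mult_less_0_iff
               simp flip: has_real_derivative_iff_has_vector_derivative)
    hence "((\<lambda>x. (I \<circ> (\<lambda>x. - r * ln x)) x * (- (of_real r powr (-s)))) has_vector_derivative
             ((- r / x) *\<^sub>R g (- r * ln x)) * (- (of_real r powr (-s)))) (at x)"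
      by (rule has_vector_derivative_mult_left)
    also have "((- r / x) *\<^sub>R g (- r * ln x)) * (- (of_real r powr (-s))) =
                 log_weight s (of_real r) x"
    proof -
      have 1: "complex_of_real (- r * ln x) powr (s - 1) =
              of_real r powr (s - 1) * of_real (- ln x) powr (s - 1)"
      proof -
        have "complex_of_real (- r * ln x) = of_real r * of_real (- ln x)" by simp
        thus ?thesis using r ln by (simp only:) (rule powr_times_real, auto)
      qed
      have 2: "complex_of_real (exp (- r * ln x)) = inverse (of_real x powr of_real r)"
        using x by (simp add: powr_def exp_minus Ln_of_real mult.commute flip: exp_of_real)
      have 3: "complex_of_real x powr (of_real r - 1) = of_real x powr of_real r / of_real x"
        using x by (simp add: powr_diff)
      have 4: "complex_of_real r powr (s - 1) = of_real r powr s / of_real r"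
              "complex_of_real r powr (- s) = inverse (of_real r powr s)"
        using r by (simp_all add: powr_diff powr_minus)
      have [simp]: "of_real x powr complex_of_real r \<noteq> 0" "complex_of_real r powr s \<noteq> 0"
        using x r by auto
      show ?thesis
        using x r unfolding g_def 1 2
        by (subst log_weight_eq) (auto simp: 3 4 scaleR_conv_of_real field_simps)
    qed
    finally show "(A has_vector_derivative log_weight s (of_real r) x) (at x)"
      by (rule has_vector_derivative_transform_within_open[of _ _ _ "{0<..}"])
         (use x in \<open>auto simp: A_def\<close>)
  qed (use A_cont in auto)
  thus ?thesis
    by (simp add: A_def I_def)
qed

text \<open>
  Both sides are holomorphic in \<open>w\<close> and agree for real \<open>w\<close>. This replaces the rotation of the
  contour that a direct substitution with complex \<open>w\<close> would require.
\<close>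
lemma log_moment:
  assumes s: "Re s > 1" and w: "Re w > Re s + 1"
  shows   "integral {0..1} (log_weight s w) = Gamma s * w powr (-s)"
proof -
  let ?S = "{w. Re w > Re s + 1}"
  have "integral {0..1} (log_weight s w) - Gamma s * w powr (-s) = 0"
  proof (rule analytic_continuation[of "\<lambda>w. integral {0..1} (log_weight s w) - Gamma s * w powr (-s)"
                 ?S "of_real ` {Re s + 1<..}" "of_real (Re s + 2)"])
    show "(\<lambda>w. integral {0..1} (log_weight s w) - Gamma s * w powr (-s)) holomorphic_on ?S"
      using s by (intro holomorphic_intros holomorphic_log_moment)
                 (auto simp: complex_nonpos_Reals_iff)
    show "connected ?S" by (intro convex_connected convex_halfspace_Re_gt)
    show "complex_of_real (Re s + 2) islimpt of_real ` {Re s + 1<..}"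
      unfolding islimpt_sequential
    proof (intro exI[of _ "\<lambda>n. complex_of_real (Re s + 2 + inverse (real (Suc n)))"] conjI allI)
      show "(\<lambda>n. complex_of_real (Re s + 2 + inverse (real (Suc n)))) \<longlonglongrightarrow> of_real (Re s + 2)"
        by (intro tendsto_of_real LIMSEQ_inverse_real_of_nat_add)
      fix n :: nat
      define e where "e = inverse (real (Suc n))"
      have "e > 0" by (simp add: e_def)
      have "Re s + 2 + e \<in> {Re s + 1<..}" "Re s + 2 + e \<noteq> Re s + 2"
        using \<open>e > 0\<close> by auto
      thus "complex_of_real (Re s + 2 + inverse (real (Suc n)))
              \<in> of_real ` {Re s + 1<..} - {complex_of_real (Re s + 2)}"
        unfolding e_def[symmetric] Diff_iff singleton_iff of_real_eq_iff by blast
    qed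
    show "integral {0..1} (log_weight s z) - Gamma s * z powr (-s) = 0"
      if z: "z \<in> of_real ` {Re s + 1<..}" for z
    proof -
      from z obtain r where r: "z = of_real r" "r > Re s + 1" by auto
      with s have "r > 0" by linarith
      from integral_unique[OF log_moment_real[OF s this]] show ?thesis by (simp add: r(1))
    qed
  qed (use w in \<open>auto simp: open_halfspace_Re_gt\<close>)
  thus ?thesis by simp
qed

text \<open>
  Convergence of the series is made part of the definition, so that summability on the unit disc
  comes with the existence of a continuation.
\<close>
definition lerch_continuation :: "complex \<Rightarrow> complex \<Rightarrow> (complex \<Rightarrow> complex) \<Rightarrow> bool" where
  "lerch_continuation s v f \<longleftrightarrow> f holomorphic_on slit_plane \<and>
     (\<forall>z. norm z < 1 \<longrightarrow> (\<lambda>j. z ^ j / (of_nat j + v) powr s) sums f z)"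

lemma Stieltjes_transform_holomorphic:
  fixes g :: "real \<Rightarrow> complex"
  assumes g: "continuous_on {0..1} g"
  shows   "(\<lambda>z. integral {0..1} (\<lambda>x. g x / (1 - z * of_real x))) holomorphic_on slit_plane"
proof -
  have nz: "1 - z * of_real x \<noteq> 0" if "z \<in> slit_plane" "x \<in> {0..1}" for z x
  proof
    assume eq: "1 - z * of_real x = 0"
    hence "x \<noteq> 0" by auto
    moreover from eq have "z * of_real x = 1" by simp
    ultimately have "z = of_real (1 / x)" by (simp add: eq_divide_eq)
    hence "Im z = 0" "Re z = 1 / x" by (simp_all only: Re_complex_of_real Im_complex_of_real)
    moreover have "1 / x \<ge> 1" using that(2) \<open>x \<noteq> 0\<close> by simp
    ultimately show False using that(1) unfolding in_slit_plane_iff by linarith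
  qed
  show ?thesis
  proof (rule holomorphic_onI)
    fix z assume z: "z \<in> slit_plane"
    obtain e where e: "e > 0" "ball z e \<subseteq> slit_plane"
      using open_slit_plane z by (meson open_contains_ball)
    have "(\<lambda>z. integral (cbox 0 1) (\<lambda>x. g x / (1 - z * of_real x))) holomorphic_on ball z e"
    proof (rule leibniz_rule_holomorphic[where fx = "\<lambda>z x. g x * of_real x / (1 - z * of_real x) ^ 2"])
      fix u x assume u: "u \<in> ball z e" and x: "x \<in> cbox (0 :: real) 1"
      have "1 - u * of_real x \<noteq> 0" using u x e by (intro nz) auto
      thus "((\<lambda>z. g x / (1 - z * of_real x)) has_field_derivative
              g x * of_real x / (1 - u * of_real x) ^ 2) (at u within ball z e)"
        by (auto intro!: derivative_eq_intros simp: power2_eq_square)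
    next
      fix u assume u: "u \<in> ball z e"
      show "(\<lambda>x. g x / (1 - u * of_real x)) integrable_on cbox 0 1"
        unfolding cbox_interval using u e
        by (intro integrable_continuous_real continuous_intros g ballI nz) auto
    next
      have "continuous_on (ball z e \<times> {0..1}) (\<lambda>p. g (snd p))"
        by (rule continuous_on_compose2[OF g]) (auto intro!: continuous_intros)
      thus "continuous_on (ball z e \<times> cbox 0 1) (\<lambda>(z, x). g x * of_real x / (1 - z * of_real x) ^ 2)"
        unfolding case_prod_unfold cbox_interval using e
        by (intro continuous_intros ballI power_not_zero nz) auto
    qed auto
    hence "(\<lambda>z. integral {0..1} (\<lambda>x. g x / (1 - z * of_real x))) field_differentiable at z"
      using e(1) by (intro holomorphic_on_imp_differentiable_at[of _ "ball z e"]) auto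
    thus "(\<lambda>z. integral {0..1} (\<lambda>x. g x / (1 - z * of_real x))) field_differentiable at z within slit_plane"
      by (rule field_differentiable_at_within)
  qed
qed

lemma Stieltjes_transform_sums:
  fixes g :: "real \<Rightarrow> complex"
  assumes g: "continuous_on {0..1} g" and z: "norm z < 1"
  shows   "(\<lambda>j. z ^ j * integral {0..1} (\<lambda>x. g x * of_real x ^ j)) sums
             integral {0..1} (\<lambda>x. g x / (1 - z * of_real x))"
proof -
  obtain B where B: "\<And>x. x \<in> {0..1} \<Longrightarrow> norm (g x) \<le> B"
    using compact_imp_bounded[OF compact_continuous_image[OF g]] unfolding bounded_iff by force
  have zx: "norm (z * of_real x) < 1" if "x \<in> {0..1}" for x :: real
  proof -
    have "norm z * \<bar>x\<bar> \<le> norm z" using that by (intro mult_left_le) auto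
    with z show ?thesis by (simp add: norm_mult)
  qed
  have term_cont: "continuous_on {0..1} (\<lambda>x. z ^ j * (g x * of_real x ^ j))" for j
    by (intro continuous_intros g)
  have ulim: "uniform_limit {0..1} (\<lambda>n x. \<Sum>j<n. z ^ j * (g x * of_real x ^ j))
          (\<lambda>x. \<Sum>j. z ^ j * (g x * of_real x ^ j)) sequentially"
  proof (rule Weierstrass_m_test)
    show "summable (\<lambda>j. B * norm z ^ j)"
      using z by (intro summable_mult summable_geometric) auto
    fix j x assume x: "x \<in> {0..(1::real)}"
    have "norm (z ^ j * (g x * of_real x ^ j)) = norm (g x) * norm (z * of_real x) ^ j"
      by (simp add: norm_mult norm_power power_mult_distrib mult_ac)
    also have "norm (z * of_real x) \<le> norm z"
      using x by (simp add: norm_mult mult_left_le)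
    hence "norm (g x) * norm (z * of_real x) ^ j \<le> B * norm z ^ j"
      using B[OF x] order.trans[OF norm_ge_zero B[OF x]] by (intro mult_mono power_mono) auto
    finally show "norm (z ^ j * (g x * of_real x ^ j)) \<le> B * norm z ^ j" .
  qed
  obtain I J where IJ:
    "\<And>n. ((\<lambda>x. \<Sum>j<n. z ^ j * (g x * of_real x ^ j)) has_integral I n) {0..1}"
    "((\<lambda>x. \<Sum>j. z ^ j * (g x * of_real x ^ j)) has_integral J) {0..1}" "I \<longlonglongrightarrow> J"
    by (rule uniform_limit_integral[OF ulim]) (auto intro!: continuous_intros g)
  have "I n = (\<Sum>j<n. z ^ j * integral {0..1} (\<lambda>x. g x * of_real x ^ j))" for n
  proof -
    have "I n = integral {0..1} (\<lambda>x. \<Sum>j<n. z ^ j * (g x * of_real x ^ j))"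
      using IJ(1)[of n] by (simp add: integral_unique)
    also have "\<dots> = (\<Sum>j<n. integral {0..1} (\<lambda>x. z ^ j * (g x * of_real x ^ j)))"
      by (intro integral_sum integrable_continuous_real term_cont) auto
    finally show ?thesis by simp
  qed
  hence "I = (\<lambda>n. \<Sum>j<n. z ^ j * integral {0..1} (\<lambda>x. g x * of_real x ^ j))" ..
  with IJ(3) have "(\<lambda>j. z ^ j * integral {0..1} (\<lambda>x. g x * of_real x ^ j)) sums J"
    by (simp only: sums_def)
  also have "J = integral {0..1} (\<lambda>x. \<Sum>j. z ^ j * (g x * of_real x ^ j))"
    using IJ(2) by (simp add: integral_unique)
  also have "\<dots> = integral {0..1} (\<lambda>x. g x / (1 - z * of_real x))"
  proof (rule integral_cong)
    fix x :: real assume x: "x \<in> {0..1}"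
    have "(\<lambda>j. g x * (z * of_real x) ^ j) sums (g x * (1 / (1 - z * of_real x)))"
      by (intro sums_mult geometric_sums zx x)
    thus "(\<Sum>j. z ^ j * (g x * of_real x ^ j)) = g x / (1 - z * of_real x)"
      by (simp add: sums_iff power_mult_distrib mult_ac)
  qed
  finally show ?thesis .
qed

text \<open>
  By \<open>log_moment\<close> the coefficients \<open>(j + v)^(-s)\<close> are, up to the factor \<open>\<Gamma>(s)\<close>, the moments of
  \<open>log_weight s v\<close>, so the Stieltjes transform of this weight is the continuation.
\<close>
lemma lerch_continuation_base:
  assumes s: "Re s > 1" and v: "Re v > Re s + 1"
  shows   "\<exists>f. lerch_continuation s v f"
proof -
  define F where "F = (\<lambda>z. integral {0..1} (\<lambda>x. log_weight s v x / (1 - z * of_real x)))"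
  have cont: "continuous_on {0..1} (log_weight s v)"
  proof -
    have "continuous_on {0..1} (\<lambda>x. (case (v, x) of (w, x) \<Rightarrow> log_weight s w x))"
      by (rule continuous_on_compose2[OF continuous_on_log_weight[of s "{v}"]])
         (use s v in \<open>auto intro!: continuous_intros\<close>)
    thus ?thesis by simp
  qed
  have [simp]: "Gamma s \<noteq> 0"
    using s by (auto simp: Gamma_eq_zero_iff elim!: nonpos_Ints_cases)
  have "lerch_continuation s v (\<lambda>z. F z / Gamma s)"
    unfolding lerch_continuation_def
  proof (intro conjI allI impI)
    show "(\<lambda>z. F z / Gamma s) holomorphic_on slit_plane"
      unfolding F_def by (intro holomorphic_intros Stieltjes_transform_holomorphic cont) auto
    fix z :: complex assume z: "norm z < 1"
    have "integral {0..1} (\<lambda>x. log_weight s v x * of_real x ^ j) =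
            Gamma s * (of_nat j + v) powr (-s)" for j
    proof -
      have "integral {0..1} (\<lambda>x. log_weight s v x * of_real x ^ j) =
              integral {0..1} (log_weight s (v + of_nat j))"
        by (intro integral_cong) (simp add: log_weight_add_of_nat)
      also have "\<dots> = Gamma s * (v + of_nat j) powr (-s)"
        using s v by (intro log_moment) auto
      finally show ?thesis by (simp add: add_ac)
    qed
    hence "(\<lambda>j. z ^ j * (Gamma s * (of_nat j + v) powr (-s)) / Gamma s) sums (F z / Gamma s)"
      using sums_divide[OF Stieltjes_transform_sums[OF cont z], of "Gamma s"] by (simp add: F_def)
    thus "(\<lambda>j. z ^ j / (of_nat j + v) powr s) sums (F z / Gamma s)"
      by (simp add: powr_minus field_simps)
  qed
  thus ?thesis by blast
qed

text \<open>
  On the \<open>j\<close>-th power of \<open>z\<close> the operator \<open>z d/dz + v\<close> acts as multiplication by \<open>j + v\<close>.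
\<close>
lemma lerch_continuation_decrease_exponent:
  assumes f: "lerch_continuation s v f" and v: "v \<notin> \<int>\<^sub>\<le>\<^sub>0"
  shows   "lerch_continuation (s - 1) v (\<lambda>z. z * deriv f z + v * f z)"
  unfolding lerch_continuation_def
proof (intro conjI allI impI)
  have hol: "f holomorphic_on slit_plane"
    using f by (simp add: lerch_continuation_def)
  show "(\<lambda>z. z * deriv f z + v * f z) holomorphic_on slit_plane"
    by (intro holomorphic_intros holomorphic_deriv hol open_slit_plane)
  fix z :: complex assume z: "norm z < 1"
  define c where "c = (\<lambda>j. 1 / (of_nat j + v) powr s)"
  have sums: "(\<lambda>j. c j * z ^ j) sums f z" if "norm z < 1" for z
    using f that by (simp add: lerch_continuation_def c_def)
  have summable: "summable (\<lambda>j. c j * z ^ j)" if "norm z < 1" for z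
    using sums[OF that] by (rule sums_summable)
  have "((\<lambda>z. \<Sum>j. c j * z ^ j) has_field_derivative (\<Sum>j. diffs c j * z ^ j)) (at z)"
    using summable z by (rule termdiffs_strong')
  hence "(f has_field_derivative (\<Sum>j. diffs c j * z ^ j)) (at z)"
    by (rule has_field_derivative_transform_within_open[of _ _ _ "ball 0 1"])
       (use sums z in \<open>auto simp: sums_iff\<close>)
  hence "deriv f z = (\<Sum>j. diffs c j * z ^ j)"
    by (rule DERIV_imp_deriv)
  moreover have "summable (\<lambda>j. diffs c j * z ^ j)"
    using z summable by (rule termdiff_converges)
  ultimately have "(\<lambda>j. diffs c j * z ^ j) sums deriv f z"
    by (simp add: sums_iff)
  hence "(\<lambda>j. z * (diffs c j * z ^ j)) sums (z * deriv f z)"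
    by (rule sums_mult)
  hence "(\<lambda>j. of_nat (Suc j) * c (Suc j) * z ^ Suc j) sums (z * deriv f z)"
    by (simp add: diffs_def mult_ac)
  hence "(\<lambda>j. of_nat j * c j * z ^ j) sums (z * deriv f z)"
    by (subst (asm) sums_Suc_iff) auto
  hence "(\<lambda>j. of_nat j * c j * z ^ j + v * (c j * z ^ j)) sums (z * deriv f z + v * f z)"
    by (intro sums_add sums_mult sums z)
  also have "(\<lambda>j. of_nat j * c j * z ^ j + v * (c j * z ^ j)) =
               (\<lambda>j. z ^ j / (of_nat j + v) powr (s - 1))"
  proof
    fix j
    have "of_nat j * c j * z ^ j + v * (c j * z ^ j) = z ^ j * ((of_nat j + v) * c j)"
      by (simp add: algebra_simps)
    also have "(of_nat j + v) * c j = 1 / (of_nat j + v) powr (s - 1)"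
      using of_nat_plus_nonzero[OF v, of j] by (simp add: c_def powr_diff)
    finally show "of_nat j * c j * z ^ j + v * (c j * z ^ j) = z ^ j / (of_nat j + v) powr (s - 1)"
      by simp
  qed
  finally show "(\<lambda>j. z ^ j / (of_nat j + v) powr (s - 1)) sums (z * deriv f z + v * f z)" .
qed

lemma lerch_continuation_decrease_shift:
  assumes f: "lerch_continuation s (v + 1) f"
  shows   "lerch_continuation s v (\<lambda>z. 1 / v powr s + z * f z)"
  unfolding lerch_continuation_def
proof (intro conjI allI impI)
  show "(\<lambda>z. 1 / v powr s + z * f z) holomorphic_on slit_plane"
    using f by (cases "v = 0") (auto simp: lerch_continuation_def intro!: holomorphic_intros)
  fix z :: complex assume "norm z < 1"
  hence "(\<lambda>j. z ^ j / (of_nat j + (v + 1)) powr s) sums f z"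
    using f by (simp add: lerch_continuation_def)
  hence "(\<lambda>j. z * (z ^ j / (of_nat j + (v + 1)) powr s)) sums (z * f z)"
    by (rule sums_mult)
  hence "(\<lambda>j. z ^ Suc j / (of_nat (Suc j) + v) powr s) sums (z * f z)"
    by (simp add: add_ac)
  thus "(\<lambda>j. z ^ j / (of_nat j + v) powr s) sums (1 / v powr s + z * f z)"
    by (subst (asm) sums_Suc_iff) (simp add: add_ac)
qed

lemma not_nonpos_Ints_of_Re_pos: "Re v > 0 \<Longrightarrow> v \<notin> \<int>\<^sub>\<le>\<^sub>0"
  by (auto elim!: nonpos_Ints_cases)

text \<open>
  The base case is available for \<open>s + N\<close> and \<open>v + M\<close> with suitable naturals \<open>N\<close> and \<open>M\<close>; the exponent
  is lowered first, while \<open>v\<close> still has a large real part, and the shift afterwards.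
\<close>
theorem ex_lerch_continuation: "\<exists>f. lerch_continuation s v f"
proof -
  obtain N :: nat where N: "real N > 1 - Re s"
    using reals_Archimedean2 by blast
  have 1: "\<exists>f. lerch_continuation s v f" if "Re v > \<bar>Re s\<bar> + real N + 1" for v
  proof -
    have v: "v \<notin> \<int>\<^sub>\<le>\<^sub>0" using that by (intro not_nonpos_Ints_of_Re_pos) auto
    have "\<exists>f. lerch_continuation (s + of_nat N - of_nat k) v f" for k
    proof (induction k)
      case 0
      thus ?case using N that by (intro lerch_continuation_base) auto
    next
      case (Suc k)
      thus ?case
        using lerch_continuation_decrease_exponent[OF _ v] by (force simp: algebra_simps)
    qed
    from this[of N] show ?thesis by simp
  qed
  obtain M :: nat where M: "real M > \<bar>Re s\<bar> + real N + 1 - Re v"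
    using reals_Archimedean2 by blast
  have "\<exists>f. lerch_continuation s (v + of_nat M - of_nat k) f" for k
  proof (induction k)
    case 0
    thus ?case using M by (intro 1) auto
  next
    case (Suc k)
    thus ?case
      using lerch_continuation_decrease_shift[of s "v + of_nat M - of_nat (Suc k)"]
      by (force simp: algebra_simps)
  qed
  from this[of M] show ?thesis by simp
qed

lemma lerch_continuation_unique:
  assumes "lerch_continuation s v f" "lerch_continuation s v g" "z \<in> slit_plane"
  shows   "f z = g z"
proof (rule analytic_continuation_open[of "ball 0 1" slit_plane f g])
  show "f z = g z" if "z \<in> ball 0 1" for z
    using assms that by (auto simp: lerch_continuation_def sums_iff)
qed (use assms open_slit_plane connected_slit_plane unit_disc_subset_slit_plane
     in \<open>auto simp: lerch_continuation_def\<close>)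

section \<open>Continuation in s at z = -1 and at z = 1\<close>

text \<open>
  The Taylor expansion of \<open>(j + 1 + v)^(-s)\<close> multiplied by \<open>z^(j+1)\<close> and summed over \<open>j\<close>. The left-hand
  side of the expansion then gives the series without its first term, and the \<open>k\<close>-th Taylor term the
  series with \<open>s\<close> raised by \<open>k\<close>.
\<close>
lemma continuation_Taylor_relation:
  assumes F: "\<And>t. lerch_continuation t v (F t)" and z: "norm z < 1"
  shows   "F s z = v powr (-s) + z * (\<Sum>k<K. ((-s) gchoose k) * F (s + of_nat k) z) +
                   z * (\<Sum>j. z ^ j * power_remainder K s v j)"
proof -
  have sums: "(\<lambda>j. z ^ j * (of_nat j + v) powr (-t)) sums F t z" for t
    using F[of t] z by (simp add: lerch_continuation_def powr_minus_divide)
  have "(\<lambda>j. z ^ Suc j * (of_nat (Suc j) + v) powr (-s)) sums (F s z - v powr (-s))"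
    using sums[of s] by (subst sums_Suc_iff) simp
  moreover have "(\<lambda>j. z * (\<Sum>k<K. ((-s) gchoose k) * (z ^ j * (of_nat j + v) powr (-(s + of_nat k)))))
          sums (z * (\<Sum>k<K. ((-s) gchoose k) * F (s + of_nat k) z))"
    by (intro sums_mult sums_sum sums)
  ultimately have "(\<lambda>j. z ^ Suc j * (of_nat (Suc j) + v) powr (-s) -
          z * (\<Sum>k<K. ((-s) gchoose k) * (z ^ j * (of_nat j + v) powr (-(s + of_nat k)))))
          sums (F s z - v powr (-s) - z * (\<Sum>k<K. ((-s) gchoose k) * F (s + of_nat k) z))"
    by (rule sums_diff)
  also have "(\<lambda>j. z ^ Suc j * (of_nat (Suc j) + v) powr (-s) -
          z * (\<Sum>k<K. ((-s) gchoose k) * (z ^ j * (of_nat j + v) powr (-(s + of_nat k))))) =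
          (\<lambda>j. z * (z ^ j * power_remainder K s v j))"
  proof
    fix j
    have "(\<Sum>k<K. ((-s) gchoose k) * (z ^ j * (of_nat j + v) powr (-(s + of_nat k)))) =
            z ^ j * (\<Sum>k<K. ((-s) gchoose k) * (of_nat j + v) powr (-s - of_nat k))"
      by (simp add: sum_distrib_left mult.left_commute)
    thus "z ^ Suc j * (of_nat (Suc j) + v) powr (-s) -
          z * (\<Sum>k<K. ((-s) gchoose k) * (z ^ j * (of_nat j + v) powr (-(s + of_nat k)))) =
          z * (z ^ j * power_remainder K s v j)"
      by (simp only: power_remainder_def right_diff_distrib power_Suc mult.assoc)
  qed
  finally have *: "(\<lambda>j. z * (z ^ j * power_remainder K s v j)) sums
          (F s z - v powr (-s) - z * (\<Sum>k<K. ((-s) gchoose k) * F (s + of_nat k) z))" .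
  have "z * (\<Sum>j. z ^ j * power_remainder K s v j) =
          F s z - v powr (-s) - z * (\<Sum>k<K. ((-s) gchoose k) * F (s + of_nat k) z)"
  proof (cases "z = 0")
    case True
    with sums_unique[OF *] have "F s 0 - v powr (-s) = 0" by simp
    thus ?thesis unfolding True by simp
  next
    case False
    have "summable (\<lambda>j. z ^ j * power_remainder K s v j)"
      by (rule summable_mult_D[OF sums_summable[OF *] False])
    thus ?thesis
      by (rule trans[OF suminf_mult [symmetric] sums_unique[OF *, symmetric]])
  qed
  thus ?thesis by (simp only: diff_eq_eq eq_diff_eq add_ac)
qed

text \<open>
  Both sides of the previous relation are continuous on the closed disc with diameter \<open>[-1, 0]\<close>,
  which touches the unit circle at \<open>-1\<close> only and stays clear of the cut: the continuations because
  they are holomorphic there, the sum of remainders because it converges absolutely on the closed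
  unit disc. So the relation extends from the interior to \<open>z = -1\<close>.
\<close>
lemma continuation_Taylor_relation_minus_1:
  assumes F: "\<And>t. lerch_continuation t v (F t)" and s: "Re s > 1 - real K"
  shows   "F s (-1) = v powr (-s) - (\<Sum>k<K. ((-s) gchoose k) * F (s + of_nat k) (-1)) -
                   (\<Sum>j. (-1) ^ j * power_remainder K s v j)"
proof -
  define D where "D = (\<lambda>z. F s z - (v powr (-s) + z * (\<Sum>k<K. ((-s) gchoose k) * F (s + of_nat k) z) +
                   z * (\<Sum>j. z ^ j * power_remainder K s v j)))"
  let ?S = "ball (-1/2) (1/2) :: complex set"
  have cl: "closure ?S = cball (-1/2) (1/2)" by simp
  have sub: "cball (-1/2) (1/2) \<subseteq> (cball 0 1 :: complex set)" "ball (-1/2) (1/2) \<subseteq> (ball 0 1 :: complex set)"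
    by (auto simp: cball_subset_cball_iff ball_subset_ball_iff dist_norm)
  have slit: "cball (-1/2) (1/2) \<subseteq> slit_plane"
  proof
    fix z :: complex assume "z \<in> cball (-1/2) (1/2)"
    hence "norm (z + 1/2) \<le> 1/2"
      by (simp add: dist_norm norm_minus_commute)
    hence "Re z \<le> 0" using complex_Re_le_cmod[of "z + 1/2"] by simp
    thus "z \<in> slit_plane" by (simp add: in_slit_plane_iff)
  qed
  have F_cont: "continuous_on (cball (-1/2) (1/2)) (F t)" for t
    using F[of t] slit holomorphic_on_imp_continuous_on continuous_on_subset
    unfolding lerch_continuation_def by metis
  have "continuous_on (cball (-1/2) (1/2)) (\<lambda>z. \<Sum>j. z ^ j * power_remainder K s v j)"
    using continuous_on_power_series_cball[OF power_remainder_abs_summable[OF s]] sub(1)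
    by (rule continuous_on_subset)
  hence "continuous_on (closure ?S) D"
    unfolding cl D_def by (intro continuous_intros F_cont)
  moreover have "D z = 0" if "z \<in> ?S" for z
  proof -
    have "norm z < 1" using sub(2) that by auto
    from continuation_Taylor_relation[of v F, OF F this, of s K] show ?thesis by (simp add: D_def)
  qed
  ultimately have "D (-1) = 0"
    by (rule continuous_constant_on_closure) (auto simp: dist_norm)
  thus ?thesis by (simp add: D_def)
qed

text \<open>
  In the relation at \<open>z = -1\<close> the term for \<open>k = 0\<close> is the unknown value itself, with sign \<open>-1\<close>. Solved
  for that value, the relation involves only values at \<open>s + 1, s + 2, \<dots>\<close> and a sum of remainders that
  is holomorphic on the larger half-plane.
\<close>
lemma holomorphic_continuation_at_minus_1:
  assumes v: "v \<notin> \<int>\<^sub>\<le>\<^sub>0" and F: "\<And>t. lerch_continuation t v (F t)"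
  shows   "(\<lambda>s. F s (-1)) holomorphic_on UNIV"
proof -
  have powr_hol: "(\<lambda>s. v powr (-s)) holomorphic_on A" for A
    by (intro holomorphic_intros)
  have half: "(\<lambda>s. F s (-1)) holomorphic_on {s. Re s > 1 - real K}" for K
  proof (induction K)
    case 0
    have "(\<lambda>s. v powr (-s) - (\<Sum>j. (-1) ^ j * power_remainder 0 s v j))
             holomorphic_on {s. Re s > 1 - real 0}"
      by (intro holomorphic_intros powr_hol holomorphic_power_remainder_suminf v) auto
    thus ?case
      by (rule holomorphic_transform)
         (use continuation_Taylor_relation_minus_1[of v F, OF F, of 0] in auto)
  next
    case (Suc K)
    let ?H = "{s. Re s > 1 - real (Suc K)}"
    have "(\<lambda>s. (v powr (-s) - (\<Sum>k<K. ((-s) gchoose Suc k) * F (s + of_nat (Suc k)) (-1)) -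
             (\<Sum>j. (-1) ^ j * power_remainder (Suc K) s v j)) / 2) holomorphic_on ?H"
    proof (intro holomorphic_intros powr_hol holomorphic_power_remainder_suminf v)
      fix k :: nat assume "k \<in> {..<K}"
      show "(\<lambda>s. (-s) gchoose Suc k) holomorphic_on ?H"
        unfolding gbinomial_prod_rev by (intro holomorphic_intros) auto
      show "(\<lambda>s. F (s + of_nat (Suc k)) (-1)) holomorphic_on ?H"
        by (rule holomorphic_on_compose_gen[OF _ Suc.IH, unfolded o_def])
           (auto intro!: holomorphic_intros)
    qed auto
    thus ?case
    proof (rule holomorphic_transform)
      fix s assume "s \<in> ?H"
      hence "F s (-1) = v powr (-s) - (\<Sum>k<Suc K. ((-s) gchoose k) * F (s + of_nat k) (-1)) -
                   (\<Sum>j. (-1) ^ j * power_remainder (Suc K) s v j)"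
        by (intro continuation_Taylor_relation_minus_1 F) auto
      thus "(v powr (-s) - (\<Sum>k<K. ((-s) gchoose Suc k) * F (s + of_nat (Suc k)) (-1)) -
             (\<Sum>j. (-1) ^ j * power_remainder (Suc K) s v j)) / 2 = F s (-1)"
        by (simp add: sum.lessThan_Suc_shift algebra_simps del: sum.lessThan_Suc of_nat_Suc)
    qed
  qed
  have "(\<lambda>s. F s (-1)) field_differentiable at s" for s
  proof -
    obtain K :: nat where "real K > 1 - Re s"
      using reals_Archimedean2 by blast
    thus ?thesis
      by (intro holomorphic_on_imp_differentiable_at[OF half[of K]]) (auto simp: open_halfspace_Re_gt)
  qed
  thus ?thesis by (auto intro!: holomorphic_onI)
qed

lemma dirichlet_series_abs_summable:
  assumes "Re s > 1"
  shows   "summable (\<lambda>j. norm (1 / (of_nat j + v) powr s))"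
proof -
  have "summable (\<lambda>j. norm ((of_nat (Suc j) + v) powr (-s)))"
    using power_remainder_abs_summable[of 0 s v] assms by (simp add: power_remainder_def)
  thus ?thesis
    by (subst summable_Suc_iff [symmetric]) (simp add: powr_minus_divide)
qed

lemma dirichlet_series_shift:
  assumes "Re s > 1" "norm z \<le> 1"
  shows   "(\<Sum>j. z ^ j / (of_nat j + v) powr s) =
             v powr (-s) + z * (\<Sum>j. z ^ j * power_remainder 0 s v j)"
proof -
  have "summable (\<lambda>j. norm (z ^ j / (of_nat j + v) powr s))"
    by (rule summable_comparison_test_ev[OF _ dirichlet_series_abs_summable[OF assms(1), of v]])
       (use assms in \<open>auto simp: norm_divide norm_power intro!: always_eventually divide_right_mono power_le_one\<close>)
  hence *: "summable (\<lambda>j. z ^ j / (of_nat j + v) powr s)"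
    by (rule summable_norm_cancel)
  have "summable (\<lambda>j. norm (z ^ j * power_remainder 0 s v j))"
    by (rule summable_comparison_test_ev[OF _ power_remainder_abs_summable[of 0 s v]])
       (use assms in \<open>auto simp: norm_mult norm_power intro!: always_eventually mult_left_le_one_le power_le_one\<close>)
  hence "summable (\<lambda>j. z ^ j * power_remainder 0 s v j)"
    by (rule summable_norm_cancel)
  hence "z * (\<Sum>j. z ^ j * power_remainder 0 s v j) = (\<Sum>j. z * (z ^ j * power_remainder 0 s v j))"
    by (rule suminf_mult [symmetric])
  also have "\<dots> = (\<Sum>j. z ^ Suc j / (of_nat (Suc j) + v) powr s)"
    by (simp add: power_remainder_def powr_minus_divide mult_ac)
  finally show ?thesis
    using suminf_split_head[OF *] by (simp add: powr_minus_divide)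
qed

text \<open>
  The Taylor expansion of \<open>(j + 1 + v)^(1-s)\<close> summed over \<open>j\<close>. Its left-hand side and the term of
  order \<open>0\<close> telescope, the term of order \<open>1\<close> gives \<open>(1 - s) \<zeta>(s, v)\<close>, and the later ones give
  multiples of \<open>\<zeta>(s + 1, v), \<zeta>(s + 2, v), \<dots>\<close>. Passing to \<open>Z(s) = (s - 1) \<zeta>(s, v)\<close> cancels the poles
  of the latter, because the binomial coefficient in front of \<open>\<zeta>(s + i + 1, v)\<close> contains the
  factor \<open>s + i\<close>.
\<close>
lemma hurwitz_Taylor_relation:
  fixes s v :: complex and N :: nat
  assumes s: "Re s > 1"
  defines "Z \<equiv> (\<lambda>t. (t - 1) * (\<Sum>j. 1 / (of_nat j + v) powr t))"
  shows   "Z s = v powr (1 - s) -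
             (\<Sum>i<N. ((1 - s) gchoose Suc i) / of_nat (i + 2) * Z (s + of_nat (Suc i))) +
             (\<Sum>j. power_remainder (N + 2) (s - 1) v j)"
proof -
  define \<zeta> where "\<zeta> = (\<lambda>t. \<Sum>j. 1 / (of_nat j + v) powr t)"
  have \<zeta>: "(\<lambda>j. (of_nat j + v) powr (-t)) sums \<zeta> t" if "Re t > 1" for t
    using summable_sums[OF summable_norm_cancel[OF dirichlet_series_abs_summable[OF that, of v]]]
    by (simp add: \<zeta>_def powr_minus_divide)
  have "(\<lambda>j. (of_nat j + v) powr (1 - s)) \<longlonglongrightarrow> 0"
  proof -
    obtain C where C: "\<forall>\<^sub>F j in sequentially. \<forall>t\<in>{s - 1}.
        norm ((of_nat j + v) powr (-t)) \<le> C * real j powr (-(Re s - 1))"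
      using shift_powr_bound[of "{s - 1}" "Re s - 1" v] by auto
    have "(\<lambda>j. C * real j powr (-(Re s - 1))) \<longlonglongrightarrow> C * 0"
      using s by (intro tendsto_intros tendsto_neg_powr filterlim_real_sequentially) auto
    thus ?thesis
      using C by (auto intro: Lim_null_comparison)
  qed
  hence "(\<lambda>j. (of_nat (Suc j) + v) powr (1 - s) - (of_nat j + v) powr (1 - s)) sums
            (0 - (of_nat 0 + v) powr (1 - s))"
    by (rule telescope_sums)
  moreover have "(\<lambda>j. \<Sum>k<N+1. ((1 - s) gchoose Suc k) * (of_nat j + v) powr (-(s + of_nat k))) sums
          (\<Sum>k<N+1. ((1 - s) gchoose Suc k) * \<zeta> (s + of_nat k))"
    using s by (intro sums_sum sums_mult \<zeta>) auto
  ultimately have "(\<lambda>j. (of_nat (Suc j) + v) powr (1 - s) - (of_nat j + v) powr (1 - s) -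
        (\<Sum>k<N+1. ((1 - s) gchoose Suc k) * (of_nat j + v) powr (-(s + of_nat k)))) sums
        (0 - (of_nat 0 + v) powr (1 - s) - (\<Sum>k<N+1. ((1 - s) gchoose Suc k) * \<zeta> (s + of_nat k)))"
    by (rule sums_diff)
  also have "(\<lambda>j. (of_nat (Suc j) + v) powr (1 - s) - (of_nat j + v) powr (1 - s) -
        (\<Sum>k<N+1. ((1 - s) gchoose Suc k) * (of_nat j + v) powr (-(s + of_nat k)))) =
        power_remainder (N + 2) (s - 1) v"
  proof
    fix j
    have "N + 2 = Suc (N + 1)" by simp
    hence "(\<Sum>k<N+2. ((1 - s) gchoose k) * (of_nat j + v) powr (1 - s - of_nat k)) =
            (of_nat j + v) powr (1 - s) +
            (\<Sum>k<N+1. ((1 - s) gchoose Suc k) * (of_nat j + v) powr (1 - s - of_nat (Suc k)))"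
      by (simp only: sum.lessThan_Suc_shift) simp
    also have "(\<Sum>k<N+1. ((1 - s) gchoose Suc k) * (of_nat j + v) powr (1 - s - of_nat (Suc k))) =
                 (\<Sum>k<N+1. ((1 - s) gchoose Suc k) * (of_nat j + v) powr (-(s + of_nat k)))"
      by (intro sum.cong arg_cong2[of _ _ _ _ "(*)"] arg_cong2[of _ _ _ _ "(powr)"] refl) simp
    finally show "(of_nat (Suc j) + v) powr (1 - s) - (of_nat j + v) powr (1 - s) -
        (\<Sum>k<N+1. ((1 - s) gchoose Suc k) * (of_nat j + v) powr (-(s + of_nat k))) =
        power_remainder (N + 2) (s - 1) v j"
      unfolding power_remainder_def minus_diff_eq by (simp only: diff_diff_eq)
  qed
  finally have "(\<Sum>j. power_remainder (N + 2) (s - 1) v j) =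
      - (v powr (1 - s)) - (\<Sum>k<N+1. ((1 - s) gchoose Suc k) * \<zeta> (s + of_nat k))"
    by (simp add: sums_iff)
  also have "(\<Sum>k<N+1. ((1 - s) gchoose Suc k) * \<zeta> (s + of_nat k)) =
      - Z s + (\<Sum>i<N. ((1 - s) gchoose Suc (Suc i)) * \<zeta> (s + of_nat (Suc i)))"
    by (simp add: sum.lessThan_Suc_shift Z_def \<zeta>_def algebra_simps del: sum.lessThan_Suc of_nat_Suc)
  also have "(\<Sum>i<N. ((1 - s) gchoose Suc (Suc i)) * \<zeta> (s + of_nat (Suc i))) =
      (\<Sum>i<N. - ((1 - s) gchoose Suc i) / of_nat (i + 2) * Z (s + of_nat (Suc i)))"
  proof (rule sum.cong)
    fix i
    have "of_nat (i + 2) * ((1 - s) gchoose Suc (Suc i)) =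
            ((1 - s) - of_nat (Suc i)) * ((1 - s) gchoose Suc i)"
      using Suc_gbinomial_Suc[of "Suc i" "1 - s"] by simp
    moreover have "of_nat (i + 2) \<noteq> (0 :: complex)" unfolding of_nat_eq_0_iff by simp
    ultimately have "((1 - s) gchoose Suc (Suc i)) =
            ((1 - s) - of_nat (Suc i)) * ((1 - s) gchoose Suc i) / of_nat (i + 2)"
      by (simp add: nonzero_eq_divide_eq mult.commute del: of_nat_add)
    moreover have "Z (s + of_nat (Suc i)) = - ((1 - s) - of_nat (Suc i)) * \<zeta> (s + of_nat (Suc i))"
      by (simp add: Z_def \<zeta>_def)
    ultimately show "((1 - s) gchoose Suc (Suc i)) * \<zeta> (s + of_nat (Suc i)) =
            - ((1 - s) gchoose Suc i) / of_nat (i + 2) * Z (s + of_nat (Suc i))"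
      by (simp only: times_divide_eq_left times_divide_eq_right mult_minus_left mult_minus_right
                     minus_minus minus_divide_left [symmetric] mult_ac)
  qed auto
  finally show ?thesis by (simp add: sum_negf)
qed

text \<open>
  Extensions to different half-planes agree on the smaller one by the identity theorem, so they can be
  glued by choosing, at each point, any half-plane that contains it.
\<close>
lemma entire_extension_from_half_planes:
  assumes "\<And>N :: nat. \<exists>f. f holomorphic_on {s. Re s > 1 - real N} \<and> (\<forall>s. Re s > 1 \<longrightarrow> f s = g s)"
  shows   "\<exists>f. f holomorphic_on UNIV \<and> (\<forall>s. Re s > 1 \<longrightarrow> f s = g s)"
proof -
  obtain f where f: "\<And>N :: nat. f N holomorphic_on {s. Re s > 1 - real N}"
      "\<And>N s. Re s > 1 \<Longrightarrow> f N s = g s"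
    using assms by metis
  have eq: "f M s = f N s" if "Re s > 1 - real M" "Re s > 1 - real N" for M N s
  proof (rule analytic_continuation_open[of "{s. Re s > 1}" "{s. Re s > 1 - real (min M N)}" "f M" "f N"])
    show "{s. Re s > 1} \<noteq> {}" by (auto intro!: exI[of _ 2])
    show "f M holomorphic_on {s. Re s > 1 - real (min M N)}"
         "f N holomorphic_on {s. Re s > 1 - real (min M N)}"
      by (rule holomorphic_on_subset[OF f(1)], force)+
    show "connected {s. Re s > 1 - real (min M N)}"
      by (intro convex_connected convex_halfspace_Re_gt)
  qed (use that f(2) in \<open>auto simp: open_halfspace_Re_gt min_def\<close>)
  define h where "h = (\<lambda>s. f (nat \<lceil>2 - Re s\<rceil>) s)"
  have h_eq: "h s = f N s" if "Re s > 1 - real N" for N s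
    unfolding h_def using that by (intro eq) linarith+
  have "h field_differentiable at s" for s
  proof -
    obtain N :: nat where N: "real N > 1 - Re s"
      using reals_Archimedean2 by blast
    have "h holomorphic_on {s. Re s > 1 - real N}"
      by (rule holomorphic_transform[OF f(1)]) (use h_eq in auto)
    thus ?thesis
      by (rule holomorphic_on_imp_differentiable_at) (use N in \<open>auto simp: open_halfspace_Re_gt\<close>)
  qed
  hence "h holomorphic_on UNIV" by (auto intro!: holomorphic_onI)
  moreover have "h s = g s" if "Re s > 1" for s
    using h_eq[of 0 s] f(2)[of s 0] that by simp
  ultimately show ?thesis by blast
qed

text \<open>
  On the right-hand side of \<open>hurwitz_Taylor_relation\<close>, \<open>Z\<close> occurs only at points shifted to the right
  by at least \<open>1\<close>, and with \<open>N + 2\<close> Taylor terms at \<open>s - 1\<close> the remainders are summable for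
  \<open>Re s > -N\<close>. Thus an extension to \<open>Re s > 1 - N\<close> yields one to \<open>Re s > -N\<close>.
\<close>
lemma ex_hurwitz_continuation:
  assumes v: "v \<notin> \<int>\<^sub>\<le>\<^sub>0"
  shows   "\<exists>Z. Z holomorphic_on UNIV \<and>
             (\<forall>s. Re s > 1 \<longrightarrow> Z s = (s - 1) * (\<Sum>j. 1 / (of_nat j + v) powr s))"
proof (rule entire_extension_from_half_planes)
  define Z0 where "Z0 = (\<lambda>s. (s - 1) * (\<Sum>j. 1 / (of_nat j + v) powr s))"
  show "\<exists>Z. Z holomorphic_on {s. Re s > 1 - real N} \<and>
          (\<forall>s. Re s > 1 \<longrightarrow> Z s = (s - 1) * (\<Sum>j. 1 / (of_nat j + v) powr s))" for N
    unfolding Z0_def[symmetric, THEN fun_cong]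
  proof (induction N)
    case 0
    have "(\<lambda>s. (s - 1) * (v powr (-s) + (\<Sum>j. 1 ^ j * power_remainder 0 s v j)))
             holomorphic_on {s. Re s > 1 - real 0}"
      by (intro holomorphic_intros holomorphic_power_remainder_suminf v) auto
    moreover have "Z0 s = (s - 1) * (v powr (-s) + (\<Sum>j. 1 ^ j * power_remainder 0 s v j))"
      if "Re s > 1" for s
      using dirichlet_series_shift[OF that, of 1 v] by (simp add: Z0_def)
    ultimately show ?case by auto
  next
    case (Suc N)
    then obtain Z where Z: "Z holomorphic_on {s. Re s > 1 - real N}" "\<And>s. Re s > 1 \<Longrightarrow> Z s = Z0 s"
      by blast
    let ?H = "{s. Re s > 1 - real (Suc N)}"
    define Z' where "Z' = (\<lambda>s. v powr (1 - s) -
             (\<Sum>i<N. ((1 - s) gchoose Suc i) / of_nat (i + 2) * Z (s + of_nat (Suc i))) +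
             (\<Sum>j. 1 ^ j * power_remainder (N + 2) (s - 1) v j))"
    have "(\<lambda>s. v powr (1 - s)) holomorphic_on ?H"
      by (intro holomorphic_intros)
    hence "Z' holomorphic_on ?H"
      unfolding Z'_def
    proof (intro holomorphic_on_add holomorphic_on_diff holomorphic_on_sum holomorphic_on_mult
                 holomorphic_on_divide holomorphic_on_const)
      fix i :: nat
      show "(\<lambda>s. (1 - s) gchoose Suc i) holomorphic_on ?H"
        unfolding gbinomial_prod_rev by (intro holomorphic_intros) auto
      show "(\<lambda>s. Z (s + of_nat (Suc i))) holomorphic_on ?H"
        by (rule holomorphic_on_compose_gen[OF _ Z(1), unfolded o_def])
           (auto intro!: holomorphic_intros)
      show "of_nat (i + 2) \<noteq> (0 :: complex)" unfolding of_nat_eq_0_iff by simp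
    next
      show "(\<lambda>s. \<Sum>j. 1 ^ j * power_remainder (N + 2) (s - 1) v j) holomorphic_on ?H"
        by (rule holomorphic_on_compose_gen[OF _ holomorphic_power_remainder_suminf[OF v, of 1 "N + 2"],
                   unfolded o_def])
           (auto intro!: holomorphic_intros)
    qed
    moreover have "Z' s = Z0 s" if "Re s > 1" for s
      using hurwitz_Taylor_relation[OF that, of v N] that Z(2) by (simp add: Z'_def Z0_def)
    ultimately show ?case by blast
  qed
qed

section \<open>The odd part of the Lerch function\<close>

text \<open>
  For principal powers \<open>(x z)^s = x^s z^s\<close> can fail, but a positive factor leaves the argument
  unchanged.
\<close>
lemma powr_real_mult_left:
  fixes z s :: complex
  assumes "r > 0"
  shows   "(of_real r * z) powr s = of_real r powr s * z powr s"
proof (cases "z = 0")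
  case False
  with assms show ?thesis
    by (simp add: powr_def Ln_times_of_real Ln_of_real distrib_left exp_add)
qed auto

lemma lerch_phi_series:
  assumes "norm z \<le> 1" "norm z = 1 \<Longrightarrow> Re s > 1"
  shows   "lerch_phi z s v = (\<Sum>j. z ^ j / (of_nat j + v) powr s)"
  using assms by (auto simp: lerch_phi_def hurwitz_zeta_def)

lemma lerch_series_summable:
  assumes "norm z \<le> 1" "norm z = 1 \<Longrightarrow> Re s > 1"
  shows   "summable (\<lambda>j. z ^ j / (of_nat j + v) powr s)"
proof (cases "norm z = 1")
  case True
  have "summable (\<lambda>j. norm (z ^ j / (of_nat j + v) powr s))"
    using dirichlet_series_abs_summable[of s v] assms(2) True
    by (simp add: norm_divide norm_power)
  thus ?thesis by (rule summable_norm_cancel)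
next
  case False
  obtain f where "lerch_continuation s v f"
    using ex_lerch_continuation by blast
  with False assms(1) show ?thesis
    unfolding lerch_continuation_def by (metis order.not_eq_order_implies_strict sums_summable)
qed

text \<open>
  Existence and uniqueness of the continuation together make the definite description denote its
  value.
\<close>
lemma lerch_phi_continuation:
  assumes f: "lerch_continuation s v f" and z: "z \<in> slit_plane"
    and out: "norm z \<ge> 1" "norm z = 1 \<Longrightarrow> Re s \<le> 1"
  shows   "lerch_phi z s v = f z"
proof -
  have "z \<noteq> 1" using z by (auto simp: in_slit_plane_iff)
  have *: "(g holomorphic_on (- (of_real ` {1..})) \<and>
         (\<forall>z'. norm z' < 1 \<longrightarrow> g z' = (\<Sum>j. z' ^ j / (of_nat j + v) powr s))) \<longleftrightarrow>
         lerch_continuation s v g" for g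
    using lerch_series_summable[of _ s v]
    by (auto simp: lerch_continuation_def slit_plane_def sums_iff)
  have "(THE w. \<exists>g. g holomorphic_on (- (of_real ` {1..})) \<and>
              (\<forall>z'. norm z' < 1 \<longrightarrow> g z' = (\<Sum>j. z' ^ j / (of_nat j + v) powr s)) \<and>
              g z = w) = (THE w. \<exists>g. lerch_continuation s v g \<and> g z = w)"
    unfolding *[symmetric] conj_assoc ..
  also have "\<dots> = f z"
    by (rule the_equality) (use f lerch_continuation_unique[OF _ f z] in blast)+
  finally show ?thesis
    using out \<open>z \<noteq> 1\<close> unfolding lerch_phi_def by auto
qed

lemma hurwitz_zeta_continuation:
  assumes Z: "Z holomorphic_on UNIV"
    and Z_eq: "\<And>s. Re s > 1 \<Longrightarrow> Z s = (s - 1) * (\<Sum>j. 1 / (of_nat j + v) powr s)"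
    and s: "s \<noteq> 1"
  shows   "hurwitz_zeta s v = Z s / (s - 1)"
proof (cases "Re s > 1")
  case True
  thus ?thesis using Z_eq[OF True] s by (simp add: hurwitz_zeta_def)
next
  case False
  let ?P = "\<lambda>f. f holomorphic_on (- {1}) \<and>
              (\<forall>s'. Re s' > 1 \<longrightarrow> f s' = (\<Sum>j. 1 / (of_nat j + v) powr s'))"
  let ?f = "\<lambda>s. Z s / (s - 1)"
  have P: "?P ?f"
  proof (intro conjI allI impI)
    show "?f holomorphic_on (-{1})"
      by (intro holomorphic_intros holomorphic_on_subset[OF Z]) auto
    fix s' :: complex assume "Re s' > 1"
    moreover from this have "s' \<noteq> 1" by auto
    ultimately show "?f s' = (\<Sum>j. 1 / (of_nat j + v) powr s')" by (simp add: Z_eq)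
  qed
  have uniq: "f s = ?f s" if f: "?P f" for f
  proof (rule analytic_continuation_open[of "{s. Re s > 1}" "-{1}" f ?f])
    show "{s. Re s > 1} \<noteq> {}" by (auto intro!: exI[of _ 2])
    show "connected (- {1 :: complex})"
      by (rule connected_punctured_universe) simp
    show "f s' = ?f s'" if "s' \<in> {s. Re s > 1}" for s'
      using that P f by simp
  qed (use P f s in \<open>auto simp: open_halfspace_Re_gt\<close>)
  have "hurwitz_zeta s v = (THE w. \<exists>f. ?P f \<and> f s = w)"
    using False by (simp add: hurwitz_zeta_def)
  also have "\<dots> = ?f s"
    by (rule the_equality) (use P uniq in blast)+
  finally show ?thesis .
qed

text \<open>
  The terms of even index cancel, those of odd index double, and \<open>2i + 1 + v = 2 (i + (v + 1)/2)\<close>.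
\<close>
lemma odd_part_series:
  fixes z s v :: complex
  assumes "summable (\<lambda>j. z ^ j / (of_nat j + v) powr s)"
    and "summable (\<lambda>j. (-z) ^ j / (of_nat j + v) powr s)"
    and "summable (\<lambda>j. (z\<^sup>2) ^ j / (of_nat j + (v + 1) / 2) powr s)"
  shows "(\<Sum>j. z ^ j / (of_nat j + v) powr s) - (\<Sum>j. (-z) ^ j / (of_nat j + v) powr s) =
           2 powr (1 - s) * z * (\<Sum>j. (z\<^sup>2) ^ j / (of_nat j + (v + 1) / 2) powr s)"
proof -
  define f where "f = (\<lambda>j. z ^ j / (of_nat j + v) powr s - (-z) ^ j / (of_nat j + v) powr s)"
  have "f sums ((\<Sum>j. z ^ j / (of_nat j + v) powr s) - (\<Sum>j. (-z) ^ j / (of_nat j + v) powr s))"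
    unfolding f_def using assms by (intro sums_diff summable_sums)
  moreover have "f j = 0" if "j \<notin> range (\<lambda>i. Suc (2 * i))" for j
  proof -
    have "even j"
      using that by (metis oddE rangeI Suc_eq_plus1)
    thus ?thesis by (simp add: f_def)
  qed
  ultimately have "(\<lambda>i. f (Suc (2 * i))) sums
      ((\<Sum>j. z ^ j / (of_nat j + v) powr s) - (\<Sum>j. (-z) ^ j / (of_nat j + v) powr s))"
    by (subst sums_mono_reindex) (auto simp: strict_mono_def)
  moreover have "f (Suc (2 * i)) = 2 powr (1 - s) * z * ((z\<^sup>2) ^ i / (of_nat i + (v + 1) / 2) powr s)" for i
  proof -
    have "of_nat (Suc (2 * i)) + v = complex_of_real 2 * (of_nat i + (v + 1) / 2)"
      by (simp add: field_simps)
    hence "(of_nat (Suc (2 * i)) + v) powr s = 2 powr s * (of_nat i + (v + 1) / 2) powr s"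
      by (simp only: powr_real_mult_left[of 2, OF zero_less_numeral])
         (simp only: of_real_numeral)
    moreover have "f (Suc (2 * i)) = 2 * z * (z\<^sup>2) ^ i / (of_nat (Suc (2 * i)) + v) powr s"
      by (simp add: f_def power_mult power2_eq_square)
    ultimately show ?thesis by (simp add: powr_diff)
  qed
  ultimately have "(\<lambda>i. 2 powr (1 - s) * z * ((z\<^sup>2) ^ i / (of_nat i + (v + 1) / 2) powr s)) sums
      ((\<Sum>j. z ^ j / (of_nat j + v) powr s) - (\<Sum>j. (-z) ^ j / (of_nat j + v) powr s))"
    by simp
  moreover have "(\<lambda>i. 2 powr (1 - s) * z * ((z\<^sup>2) ^ i / (of_nat i + (v + 1) / 2) powr s)) sums
      (2 powr (1 - s) * z * (\<Sum>j. (z\<^sup>2) ^ j / (of_nat j + (v + 1) / 2) powr s))"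
    by (intro sums_mult summable_sums assms)
  ultimately show ?thesis by (rule sums_unique2)
qed

text \<open>
  A square in \<open>[1, \<infinity>)\<close> comes from a real number of modulus at least \<open>1\<close>.
\<close>
lemma square_in_slit_plane:
  assumes "z \<in> slit_plane" "-z \<in> slit_plane"
  shows   "z\<^sup>2 \<in> slit_plane"
proof (cases "Re z = 0")
  case True
  have "- (Im z)\<^sup>2 < 1" by (rule le_less_trans[of _ 0]) auto
  thus ?thesis using True by (simp add: in_slit_plane_iff Re_power2)
next
  case False
  have "(Re z)\<^sup>2 < 1" if "Im z = 0"
  proof -
    have "\<bar>Re z\<bar> < 1" using assms that by (auto simp: in_slit_plane_iff)
    thus ?thesis by (simp add: abs_square_less_1)
  qed
  thus ?thesis using False by (auto simp: in_slit_plane_iff Re_power2 Im_power2)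
qed

text \<open>
  The points \<open>z\<close> with \<open>z\<close> and \<open>-z\<close> off the cut form a domain that is starlike with respect to \<open>0\<close>,
  hence connected, and the identity of the series on the unit disc extends to it.
\<close>
lemma odd_part_continuation:
  assumes f: "lerch_continuation s v f" and g: "lerch_continuation s ((v + 1) / 2) g"
    and z: "z \<in> slit_plane" "-z \<in> slit_plane"
  shows   "f z - f (-z) = 2 powr (1 - s) * z * g (z\<^sup>2)"
proof -
  define D where "D = slit_plane \<inter> uminus ` slit_plane"
  have D_iff: "z \<in> D \<longleftrightarrow> (Im z = 0 \<longrightarrow> \<bar>Re z\<bar> < 1)" for z
  proof -
    have "z \<in> uminus ` slit_plane \<longleftrightarrow> -z \<in> slit_plane"
      by (metis imageE image_eqI minus_minus)
    thus ?thesis by (auto simp: D_def in_slit_plane_iff)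
  qed
  have "open D"
    unfolding D_def by (intro open_Int open_slit_plane open_negations)
  have "starlike D"
    unfolding starlike_def
  proof (intro bexI[of _ 0] ballI subsetI)
    fix x y assume x: "x \<in> D" and "y \<in> closed_segment 0 x"
    then obtain t where t: "y = of_real t * x" "0 \<le> t" "t \<le> 1"
      by (auto simp: closed_segment_def scaleR_conv_of_real)
    show "y \<in> D"
    proof (cases "t = 0")
      case False
      have "t * \<bar>Re x\<bar> \<le> \<bar>Re x\<bar>" using t by (intro mult_left_le_one_le) auto
      thus ?thesis using x t False by (auto simp: D_iff abs_mult)
    qed (auto simp: t D_iff)
  qed (auto simp: D_iff)
  hence "connected D" by (rule starlike_imp_connected)
  have maps: "w \<in> slit_plane" "-w \<in> slit_plane" "w\<^sup>2 \<in> slit_plane" if "w \<in> D" for w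
  proof -
    show "w \<in> slit_plane" "-w \<in> slit_plane"
      using that by (auto simp: D_iff in_slit_plane_iff)
    thus "w\<^sup>2 \<in> slit_plane" by (rule square_in_slit_plane)
  qed
  have hol: "f holomorphic_on slit_plane" "g holomorphic_on slit_plane"
    using f g by (auto simp: lerch_continuation_def)
  show ?thesis
  proof (rule analytic_continuation_open[of "ball 0 1" D "\<lambda>z. f z - f (-z)"
                "\<lambda>z. 2 powr (1 - s) * z * g (z\<^sup>2)"])
    show "ball 0 1 \<subseteq> D"
      by (auto simp: D_iff intro: le_less_trans[OF abs_Re_le_cmod])
    show "(\<lambda>z. f z - f (-z)) holomorphic_on D"
      by (intro holomorphic_on_diff holomorphic_on_compose_gen[OF _ hol(1), unfolded o_def, of uminus]
                holomorphic_on_subset[OF hol(1)] holomorphic_on_minus holomorphic_on_ident)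
         (use maps in auto)
    show "(\<lambda>z. 2 powr (1 - s) * z * g (z\<^sup>2)) holomorphic_on D"
      by (intro holomorphic_intros holomorphic_on_compose_gen[OF _ hol(2), unfolded o_def, of "\<lambda>z. z\<^sup>2"])
         (use maps in auto)
    show "f w - f (-w) = 2 powr (1 - s) * w * g (w\<^sup>2)" if "w \<in> ball 0 1" for w
    proof -
      have "norm w < 1" "norm (-w) < 1" "norm (w\<^sup>2) < 1"
        using that by (simp_all add: norm_power power_less_one_iff abs_square_less_1)
      hence sums: "(\<lambda>j. w ^ j / (of_nat j + v) powr s) sums f w"
          "(\<lambda>j. (-w) ^ j / (of_nat j + v) powr s) sums f (-w)"
          "(\<lambda>j. (w\<^sup>2) ^ j / (of_nat j + (v + 1) / 2) powr s) sums g (w\<^sup>2)"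
        using f g unfolding lerch_continuation_def by blast+
      from odd_part_series[OF sums[THEN sums_summable]] show ?thesis
        unfolding sums[THEN sums_unique, symmetric] .
    qed
    show "z \<in> D" using z by (auto simp: D_iff in_slit_plane_iff)
  qed (use \<open>open D\<close> \<open>connected D\<close> in auto)
qed

text \<open>
  At \<open>z = 1\<close> a continuation in \<open>z\<close> is not available, but all three terms are holomorphic in \<open>s\<close> away
  from \<open>s = 1\<close>, and for \<open>Re s > 1\<close> they are given by series. The link between the two ways of
  continuing is that the value at \<open>-1\<close> obtained by continuation in \<open>z\<close> depends holomorphically
  on \<open>s\<close>.
\<close>
lemma odd_part_at_1:
  assumes v: "v \<notin> \<int>\<^sub>\<le>\<^sub>0" and v': "(v + 1) / 2 \<notin> \<int>\<^sub>\<le>\<^sub>0"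
    and s: "Re s \<le> 1" "s \<noteq> 1"
  shows "lerch_phi 1 s v - lerch_phi (-1) s v = 2 powr (1 - s) * lerch_phi 1 s ((v + 1) / 2)"
proof -
  have "\<forall>t. \<exists>f. lerch_continuation t v f"
    using ex_lerch_continuation by blast
  then obtain F where "\<forall>t. lerch_continuation t v (F t)"
    by (rule choice[THEN exE])
  hence F: "lerch_continuation t v (F t)" for t by blast
  obtain Z where Z: "Z holomorphic_on UNIV"
      "\<And>s. Re s > 1 \<Longrightarrow> Z s = (s - 1) * (\<Sum>j. 1 / (of_nat j + v) powr s)"
    using ex_hurwitz_continuation[OF v] by blast
  obtain Z' where Z': "Z' holomorphic_on UNIV"
      "\<And>s. Re s > 1 \<Longrightarrow> Z' s = (s - 1) * (\<Sum>j. 1 / (of_nat j + (v + 1) / 2) powr s)"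
    using ex_hurwitz_continuation[OF v'] by blast
  have F_series: "F t (-1) = (\<Sum>j. (-1) ^ j / (of_nat j + v) powr t)" if "Re t > 1" for t
    using continuation_Taylor_relation_minus_1[of v F 0 t, OF F] dirichlet_series_shift[of t "-1" v] that
    by simp
  have "Z s / (s - 1) - F s (-1) = 2 powr (1 - s) * (Z' s / (s - 1))"
  proof (rule analytic_continuation_open[of "{s. Re s > 1}" "-{1}"
            "\<lambda>s. Z s / (s - 1) - F s (-1)" "\<lambda>s. 2 powr (1 - s) * (Z' s / (s - 1))"])
    show "{s. Re s > 1} \<noteq> {}" by (auto intro!: exI[of _ 2])
    show "connected (- {1 :: complex})"
      by (rule connected_punctured_universe) simp
    show "(\<lambda>s. Z s / (s - 1) - F s (-1)) holomorphic_on -{1}"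
         "(\<lambda>s. 2 powr (1 - s) * (Z' s / (s - 1))) holomorphic_on -{1}"
      by (intro holomorphic_intros holomorphic_on_subset[OF Z(1)] holomorphic_on_subset[OF Z'(1)]
                holomorphic_on_subset[OF holomorphic_continuation_at_minus_1[OF v F]]; force)+
    fix t assume t: "t \<in> {s. Re s > 1}"
    hence "t \<noteq> 1" by auto
    moreover have "summable (\<lambda>j. 1 ^ j / (of_nat j + u) powr t)"
        "summable (\<lambda>j. (-1) ^ j / (of_nat j + u) powr t)" for u
      using t by (intro lerch_series_summable; simp)+
    ultimately show "Z t / (t - 1) - F t (-1) = 2 powr (1 - t) * (Z' t / (t - 1))"
      using odd_part_series[of 1 v t] t by (simp add: Z(2) Z'(2) F_series)
  qed (use s in \<open>auto simp: open_halfspace_Re_gt\<close>)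
  moreover have "lerch_phi 1 s v = Z s / (s - 1)" "lerch_phi 1 s ((v + 1) / 2) = Z' s / (s - 1)"
    using hurwitz_zeta_continuation[OF Z s(2)] hurwitz_zeta_continuation[OF Z' s(2)]
    by (auto simp: lerch_phi_def)
  moreover have "lerch_phi (-1) s v = F s (-1)"
    by (rule lerch_phi_continuation[OF F]) (use s in \<open>auto simp: in_slit_plane_iff\<close>)
  ultimately show ?thesis by simp
qed

text \<open>
  The three cases are the ways in which \<open>\<Phi>\<close> obtains its values. The same case applies to \<open>z\<close>, \<open>-z\<close>
  and \<open>z\<^sup>2\<close>, because \<open>\<bar>z\<^sup>2\<bar>\<close> lies on the same side of \<open>1\<close> as \<open>\<bar>z\<bar>\<close>.
\<close>
theorem lerch_phi_odd_part:
  assumes z: "lerch_phi_defined z s v" and mz: "lerch_phi_defined (-z) s v"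
  shows   "lerch_phi z s v - lerch_phi (-z) s v =
             2 powr (1 - s) * z * lerch_phi (z\<^sup>2) s ((v + 1) / 2)"
proof -
  have v: "v \<notin> \<int>\<^sub>\<le>\<^sub>0" using z by (simp add: lerch_phi_defined_def)
  have v': "(v + 1) / 2 \<notin> \<int>\<^sub>\<le>\<^sub>0"
  proof
    assume "(v + 1) / 2 \<in> \<int>\<^sub>\<le>\<^sub>0"
    then obtain n where "(v + 1) / 2 = - of_nat n" by (elim nonpos_Ints_cases')
    hence "v + 1 = - (2 * of_nat n)" by (simp add: field_simps)
    moreover have "of_nat (2 * n + 1) + v = 2 * of_nat n + (v + 1)" by simp
    ultimately have "of_nat (2 * n + 1) + v = 0" by (simp only: add.right_inverse)
    with of_nat_plus_nonzero[OF v] show False by blast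
  qed
  consider (series) "norm z \<le> 1" "norm z = 1 \<longrightarrow> Re s > 1"
    | (hurwitz) "z = 1 \<or> z = -1" "Re s \<le> 1"
    | (continuation) "norm z \<ge> 1" "norm z = 1 \<longrightarrow> Re s \<le> 1" "z \<noteq> 1" "z \<noteq> -1"
    by fastforce
  thus ?thesis
  proof cases
    case series
    have "norm (z\<^sup>2) \<le> 1" "norm (z\<^sup>2) = 1 \<longrightarrow> norm z = 1"
      using series(1) norm_ge_zero[of z]
      by (auto simp: norm_power power_le_one power2_eq_1_iff simp del: norm_ge_zero)
    hence conv: "norm w \<le> 1 \<and> (norm w = 1 \<longrightarrow> Re s > 1)" if "w \<in> {z, -z, z\<^sup>2}" for w
      using series that by auto
    have "lerch_phi w s u = (\<Sum>j. w ^ j / (of_nat j + u) powr s)"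
         "summable (\<lambda>j. w ^ j / (of_nat j + u) powr s)" if "w \<in> {z, -z, z\<^sup>2}" for w u
      using conv[OF that] by (auto intro!: lerch_phi_series lerch_series_summable)
    thus ?thesis by (simp add: odd_part_series)
  next
    case hurwitz
    hence "s \<noteq> 1"
      using z mz by (auto simp: lerch_phi_defined_def slit_plane_def[symmetric] in_slit_plane_iff
                          complex_slot_right_eq)
    note eq = odd_part_at_1[OF v v' hurwitz(2) this]
    from hurwitz(1) show ?thesis
    proof
      assume "z = 1"
      thus ?thesis using eq by simp
    next
      \<comment> \<open>Changing the sign of \<open>z\<close> changes the sign of both sides.\<close>
      assume "z = -1"
      thus ?thesis using eq by (simp add: algebra_simps)
    qed
  next
    case continuation
    obtain f where f: "lerch_continuation s v f" using ex_lerch_continuation by blast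
    obtain g where g: "lerch_continuation s ((v + 1) / 2) g" using ex_lerch_continuation by blast
    have slit: "z \<in> slit_plane" "-z \<in> slit_plane"
      using z mz continuation(3,4)
      by (auto simp: lerch_phi_defined_def slit_plane_def minus_equation_iff[of z 1])
    have "z\<^sup>2 \<in> slit_plane"
      using slit by (rule square_in_slit_plane)
    moreover have "norm (z\<^sup>2) \<ge> 1" "norm (z\<^sup>2) = 1 \<longrightarrow> norm z = 1"
      using continuation(1) by (auto simp: norm_power power2_eq_1_iff)
    ultimately have "lerch_phi (z\<^sup>2) s ((v + 1) / 2) = g (z\<^sup>2)"
      using continuation by (intro lerch_phi_continuation[OF g]) auto
    moreover have "lerch_phi z s v = f z" "lerch_phi (-z) s v = f (-z)"
      using continuation slit by (auto intro!: lerch_phi_continuation[OF f])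
    ultimately show ?thesis
      using odd_part_continuation[OF f g slit] by simp
  qed
qed

theorem theorem4p104:
  fixes n :: nat and k m a :: complex
  assumes "a \<noteq> 0"
    and "\<And>p. p \<le> n \<Longrightarrow>
      lerch_phi_defined (- exp (\<i> * 2 ^ (p + 1) * m)) (- k) (1 - \<i> * Ln a / 2 ^ (p + 1))"
    and "\<And>p. p \<le> n \<Longrightarrow>
      lerch_phi_defined (exp (\<i> * 2 ^ (p + 1) * m)) (- k) (1 - \<i> * Ln a / 2 ^ (p + 1))"
    and "lerch_phi_defined (exp (\<i> * 2 ^ (n + 2) * m)) (- k) (1 - \<i> * Ln a / 2 ^ (n + 2))"
    and "lerch_phi_defined (exp (2 * \<i> * m)) (- k) (1 - 1 / 2 * \<i> * Ln a)"
  shows "(\<Sum>p = 0..n. (\<i> * 2 ^ p) powr k * exp (\<i> * m * 2 ^ (p + 1)) *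
            (lerch_phi (- exp (\<i> * 2 ^ (p + 1) * m)) (- k) (1 - \<i> * Ln a / 2 ^ (p + 1)) +
             lerch_phi (exp (\<i> * 2 ^ (p + 1) * m)) (- k) (1 - \<i> * Ln a / 2 ^ (p + 1)))) =
         - 2 * ((\<i> * 2 ^ (n + 1)) powr k * exp (\<i> * m * 2 ^ (n + 2)) *
                  lerch_phi (exp (\<i> * 2 ^ (n + 2) * m)) (- k) (1 - \<i> * Ln a / 2 ^ (n + 2)) -
                \<i> powr k * exp (2 * \<i> * m) *
                  lerch_phi (exp (2 * \<i> * m)) (- k) (1 - 1 / 2 * \<i> * Ln a))"
proof -
  define z where "z = (\<lambda>p. exp (\<i> * 2 ^ (p + 1) * m))"
  define v where "v = (\<lambda>p::nat. 1 - \<i> * Ln a / 2 ^ (p + 1))"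
  define c where "c = (\<lambda>p::nat. (\<i> * 2 ^ p) powr k)"
  define T where "T = (\<lambda>p. c p * z p * lerch_phi (z p) (-k) (v p))"
  have z_Suc: "z (Suc p) = (z p)\<^sup>2" for p
    by (simp add: z_def exp_double [symmetric] mult_ac)
  have v_Suc: "v (Suc p) = (v p + 1) / 2" for p
    by (simp add: v_def field_simps)
  have c_Suc: "c (Suc p) = 2 powr k * c p" for p
    using powr_real_mult_left[of 2 "\<i> * 2 ^ p" k] by (simp add: c_def mult_ac)
  have "c p * z p * (lerch_phi (- z p) (-k) (v p) + lerch_phi (z p) (-k) (v p)) =
          2 * T p - 2 * T (Suc p)" if "p \<le> n" for p
  proof -
    have "lerch_phi (z p) (-k) (v p) - lerch_phi (- z p) (-k) (v p) =
            2 powr (1 - (-k)) * z p * lerch_phi ((z p)\<^sup>2) (-k) ((v p + 1) / 2)"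
      by (rule lerch_phi_odd_part) (use assms(2,3)[OF that] in \<open>auto simp: z_def v_def\<close>)
    hence *: "lerch_phi (- z p) (-k) (v p) = lerch_phi (z p) (-k) (v p) -
            2 * 2 powr k * z p * lerch_phi (z (Suc p)) (-k) (v (Suc p))"
      by (simp add: z_Suc v_Suc powr_add algebra_simps)
    have **: "T (Suc p) = 2 powr k * c p * (z p)\<^sup>2 * lerch_phi (z (Suc p)) (-k) (v (Suc p))"
      by (simp add: T_def c_Suc z_Suc)
    show ?thesis unfolding * ** by (simp add: T_def power2_eq_square algebra_simps)
  qed
  hence "(\<Sum>p = 0..n. c p * z p * (lerch_phi (- z p) (-k) (v p) + lerch_phi (z p) (-k) (v p))) =
           (\<Sum>p = 0..n. 2 * T p - 2 * T (Suc p))"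
    by (intro sum.cong) auto
  also have "\<dots> = (\<Sum>p<Suc n. 2 * T p - 2 * T (Suc p))"
    by (simp only: lessThan_Suc_atMost atLeast0AtMost)
  also have "\<dots> = 2 * T 0 - 2 * T (Suc n)"
    by (rule sum_lessThan_telescope')
  also have "\<dots> = -2 * (T (Suc n) - T 0)" by simp
  finally show ?thesis
    by (simp add: T_def c_def z_def v_def mult_ac)
qed

end
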